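(* Let $\Omega$ be an r.e. infinite set, and let $P\in\mathbb{P}(\Omega)$ be a discrete probability space on $\Omega$. Let $A,B\subset\Omega$ be recursive events, and suppose that $P(B)>0$. Then the following conditions are equivalent to one another. (i) The events $A$ and $B$ are independent on $P$. (ii) For every ensemble $\alpha$ for $P$, $\mathrm{C}_A(\alpha)$ is equivalent to $\mathrm{C}_{A\cap B}(\mathrm{Filtered}_B(\alpha))$. (iii) There exists an ensemble $\alpha$ for $P$ such that $\mathrm{C}_A(\alpha)$ is equivalent to $\mathrm{C}_{A\cap B}(\mathrm{Filtered}_B(\alpha))$.
   Context: Alphabets and sequences. $\mathbb{N}^+=\{1,2,3,\dots\}$. For a nonempty set $\Omega$ (alphabet), $\Omega^*$ is the set of finite strings over $\Omega$ (including the empty string $\lambda$), and $\Omega^\infty$ is the set of infinite sequences $\alpha=\alpha(1)\alpha(2)\alpha(3)\cdots$ over $\Omega$; $\alpha\upharpoonright_n$ is the string of the first $n$ elements of $\alpha$. A set $S\subset\Omega^*$ is prefix-free if no string in $S$ is a prefix of another string in $S$. For $S\subset\Omega^*$, $[S]^{\prec}=\{\alpha\in\Omega^\infty\mid \exists n\ge 0,\ \alpha\upharpoonright_n\in S\}$. An r.e. infinite set is an infinite recursively enumerable set (of finite objects usable as Turing machine inputs). A recursive event is a subset of $\Omega$ that is a recursive set. Probability spaces. For a countably infinite set $\Omega$, a discrete probability space on $\Omega$ is a function $P\colon\Omega\to\mathbb{R}$ with $P(a)\ge 0$ for all $a$ and $\sum_{a\in\Omega}P(a)=1$ (no computability is assumed);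 a finite probability space is defined in the same way for a nonempty finite $\Omega$. In both cases $\mathbb{P}(\Omega)$ is the set of all such functions. An event is a subset $A\subset\Omega$, and $P(A)=\sum_{a\in A}P(a)$. For $\sigma=\sigma_1\cdots\sigma_n\in\Omega^*$, $P(\sigma)=P(\sigma_1)\cdots P(\sigma_n)$ and $P(\lambda)=1$. The (generalized) Bernoulli measure $\lambda_P$ is the probability measure on the Borel $\sigma$-field of $\Omega^\infty$ (generated by the open sets $[S]^{\prec}$, $S\subset\Omega^*$) determined by $\lambda_P([\{\sigma\}]^{\prec})=P(\sigma)$ for all $\sigma\in\Omega^*$. Ensembles. Let $\Omega$ be an r.e. infinite set or a nonempty finite set, and $P\in\mathbb{P}(\Omega)$. A Martin-Löf $P$-test is an r.e. set $\mathcal{C}\subset\mathbb{N}^+\times\Omega^*$ such that for every $n\in\mathbb{N}^+$ the set $\mathcal{C}_n=\{\sigma\mid(n,\sigma)\in\mathcal{C}\}$ is prefix-free and $\lambda_P([\mathcal{C}_n]^{\prec})<2^{-n}$. A sequence $\alpha\in\Omega^\infty$ is Martin-Löf $P$-random if for every Martin-Löf $P$-test $\mathcal{C}$ there is $n\in\mathbb{N}^+$ with $\alpha\notin[\mathcal{C}_n]^{\prec}$. An ensemble for $P$ is a Martin-Löf $P$-random sequence in $\Omega^\infty$. Events. Events $A,B$ are independent on $P$ if $P(A\cap B)=P(A)P(B)$. For a sequence $\gamma$ over an alphabet containing $A$ as a subset, $\mathrm{C}_A(\gamma)\in\{0,1\}^\infty$ is the binary sequence whose $n$th element is $1$ if $\gamma(n)\in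 A$ and $0$ otherwise. If $\alpha\in\Omega^\infty$ contains infinitely many elements of $B$, $\mathrm{Filtered}_B(\alpha)\in B^\infty$ is the infinite sequence obtained from $\alpha$ by deleting all occurrences of elements of $\Omega\setminus B$ (well defined when $\alpha$ is an ensemble for $P$ and $P(B)>0$). Two sequences $\gamma,\delta\in\Theta^\infty$ over a finite alphabet $\Theta$ are equivalent if there exists $Q\in\mathbb{P}(\Theta)$ such that $\gamma$ and $\delta$ are both ensembles for $Q$ (here $\Theta=\{0,1\}$). *)

theory Defs
  imports
    "HOL-Probability.Stream_Space"
    "HOL-Library.Nat_Bijection"
    "HOL-Library.Sublist"
begin

section \<open>Recursive and recursively enumerable sets\<close>

text \<open>
  Total recursive functions of arity \<open>n\<close>, as functions on argument lists of length \<open>n\<close>: the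
  smallest class that contains the initial functions and is closed under composition, primitive
  recursion, and minimization of regular functions. Values on lists of the wrong length are
  irrelevant.
\<close>

inductive recursive_nary :: "nat \<Rightarrow> (nat list \<Rightarrow> nat) \<Rightarrow> bool" where
  Zero: "recursive_nary n (\<lambda>xs. 0)"
| Succ: "recursive_nary 1 (\<lambda>xs. Suc (xs ! 0))"
| Proj: "i < n \<Longrightarrow> recursive_nary n (\<lambda>xs. xs ! i)"
| Comp: "recursive_nary (length gs) f \<Longrightarrow> (\<forall>g\<in>set gs. recursive_nary n g) \<Longrightarrow>
    recursive_nary n (\<lambda>xs. f (map (\<lambda>g. g xs) gs))"
| Prec: "recursive_nary n f \<Longrightarrow> recursive_nary (Suc (Suc n)) g \<Longrightarrow>
    recursive_nary (Suc n)
      (\<lambda>xs. rec_nat (f (tl xs)) (\<lambda>y r. g (y # r # tl xs)) (hd xs))"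
| Mu: "recursive_nary (Suc n) f \<Longrightarrow> (\<forall>xs. length xs = n \<longrightarrow> (\<exists>y. f (y # xs) = 0)) \<Longrightarrow>
    recursive_nary n (\<lambda>xs. LEAST y. f (y # xs) = 0)"

definition recursive_fun :: "(nat \<Rightarrow> nat) \<Rightarrow> bool" where
  "recursive_fun f \<longleftrightarrow> (\<exists>F. recursive_nary 1 F \<and> (\<forall>x. f x = F [x]))"

definition recursive_set :: "nat set \<Rightarrow> bool" where
  "recursive_set A \<longleftrightarrow> recursive_fun (\<lambda>x. of_bool (x \<in> A))"

definition re_set :: "nat set \<Rightarrow> bool" where
  "re_set A \<longleftrightarrow> A = {} \<or> (\<exists>f. recursive_fun f \<and> A = range f)"


section \<open>Probability spaces and Bernoulli measures\<close>

text \<open>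
  Finite objects are identified with natural numbers, so an alphabet is a set \<open>\<Omega>\<close> of natural
  numbers, finite or infinite. Only the values of \<open>P\<close> on \<open>\<Omega>\<close> matter.
\<close>

definition prob_spaces :: "nat set \<Rightarrow> (nat \<Rightarrow> real) set" where
  "prob_spaces \<Omega> = {P. (\<forall>a\<in>\<Omega>. 0 \<le> P a) \<and> (P has_sum 1) \<Omega>}"

definition event_prob :: "(nat \<Rightarrow> real) \<Rightarrow> nat set \<Rightarrow> real" where
  "event_prob P A = (\<Sum>\<^sub>\<infinity>a\<in>A. P a)"

definition indep_on :: "(nat \<Rightarrow> real) \<Rightarrow> nat set \<Rightarrow> nat set \<Rightarrow> bool" where
  "indep_on P A B \<longleftrightarrow> event_prob P (A \<inter> B) = event_prob P A * event_prob P B"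

text \<open>The infinite sequences over \<open>\<Omega>\<close> are the elements of \<^term>\<open>streams \<Omega>\<close>.\<close>

definition cylinder :: "nat set \<Rightarrow> nat list set \<Rightarrow> nat stream set" where
  "cylinder \<Omega> S = {\<alpha> \<in> streams \<Omega>. \<exists>n. stake n \<alpha> \<in> S}"

definition bernoulli_measure :: "nat set \<Rightarrow> (nat \<Rightarrow> real) \<Rightarrow> nat stream measure" where
  "bernoulli_measure \<Omega> P = stream_space (point_measure \<Omega> (\<lambda>a. ennreal (P a)))"

lemma space_bernoulli_measure: "space (bernoulli_measure \<Omega> P) = streams \<Omega>"
  by (simp add: bernoulli_measure_def space_stream_space space_point_measure)

lemma prob_space_point_measure:
  assumes "P \<in> prob_spaces \<Omega>"
  shows "prob_space (point_measure \<Omega> (\<lambda>a. ennreal (P a)))"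
proof
  have nonneg: "\<And>a. a \<in> \<Omega> \<Longrightarrow> 0 \<le> P a" and sum: "(P has_sum 1) \<Omega>"
    using assms by (auto simp: prob_spaces_def)
  have abs: "Infinite_Set_Sum.abs_summable_on P \<Omega>"
    unfolding abs_summable_equivalent[symmetric]
    using has_sum_imp_summable[OF sum] by (rule summable_on_iff_abs_summable_on_real[THEN iffD1])
  have "emeasure (point_measure \<Omega> (\<lambda>a. ennreal (P a))) \<Omega> = (\<integral>\<^sup>+a. ennreal (P a) \<partial>count_space \<Omega>)"
    unfolding point_measure_def
    by (subst emeasure_density) (auto intro!: nn_integral_cong)
  also have "\<dots> = ennreal (infsetsum P \<Omega>)"
    by (rule nn_integral_conv_infsetsum) (use abs nonneg in auto)
  also have "infsetsum P \<Omega> = 1"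
    using abs sum by (simp add: infsetsum_infsum infsumI)
  finally show "emeasure (point_measure \<Omega> (\<lambda>a. ennreal (P a)))
      (space (point_measure \<Omega> (\<lambda>a. ennreal (P a)))) = 1"
    by (simp add: space_point_measure)
qed

lemma prob_space_bernoulli_measure:
  "P \<in> prob_spaces \<Omega> \<Longrightarrow> prob_space (bernoulli_measure \<Omega> P)"
  unfolding bernoulli_measure_def
  by (intro prob_space.prob_space_stream_space prob_space_point_measure)

text \<open>
  The two characteristic properties of the Bernoulli measure: it lives on the Borel sets generated
  by the open sets, and it gives the cylinder of \<open>\<sigma>\<close> the product of the probabilities of its letters.
\<close>

lemma cylinder_singleton: "\<sigma> \<in> lists \<Omega> \<Longrightarrow> cylinder \<Omega> {\<sigma>} = sstart \<Omega> \<sigma>"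
proof (rule set_eqI)
  fix \<alpha> assume \<sigma>: "\<sigma> \<in> lists \<Omega>"
  show "\<alpha> \<in> cylinder \<Omega> {\<sigma>} \<longleftrightarrow> \<alpha> \<in> sstart \<Omega> \<sigma>"
  proof (cases "\<alpha> \<in> streams \<Omega>")
    case True
    have "(\<exists>n. stake n \<alpha> = \<sigma>) \<longleftrightarrow> stake (length \<sigma>) \<alpha> = \<sigma>"
      by (metis length_stake)
    also have "\<dots> \<longleftrightarrow> (\<forall>i<length \<sigma>. \<alpha> !! i = \<sigma> ! i)"
      by (auto simp: list_eq_iff_nth_eq)
    finally show ?thesis
      using True by (simp add: cylinder_def sstart_eq)
  next
    case False
    then show ?thesis
      using sstart_in_streams[OF \<sigma>] by (auto simp: cylinder_def)
  qed
qed

lemma cylinder_Union: "cylinder \<Omega> S = (\<Union>\<sigma>\<in>S. cylinder \<Omega> {\<sigma>})"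
  by (auto simp: cylinder_def)

lemma sets_bernoulli_measure_sstart:
  "sets (bernoulli_measure \<Omega> P) = sigma_sets (streams \<Omega>) (sstart \<Omega> ` lists \<Omega> \<union> {{}})"
proof -
  have "sets (bernoulli_measure \<Omega> P) = sets (stream_space (count_space \<Omega>))"
    unfolding bernoulli_measure_def
    by (rule sets_stream_space_cong) (simp add: sets_point_measure)
  also have "\<dots> = sets (sigma (streams \<Omega>) (sstart \<Omega> ` lists \<Omega> \<union> {{}}))"
    by (rule sets_stream_space_sstart) simp
  also have "\<dots> = sigma_sets (streams \<Omega>) (sstart \<Omega> ` lists \<Omega> \<union> {{}})"
    by (rule sets_measure_of) (simp add: image_subset_iff sstart_in_streams)
  finally show ?thesis .
qed

lemma sets_bernoulli_measure:
  "sets (bernoulli_measure \<Omega> P) = sigma_sets (streams \<Omega>) (cylinder \<Omega> ` Pow (lists \<Omega>))"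
proof (rule antisym)
  have "sstart \<Omega> ` lists \<Omega> \<union> {{}} \<subseteq> cylinder \<Omega> ` Pow (lists \<Omega>)"
  proof -
    have "sstart \<Omega> \<sigma> \<in> cylinder \<Omega> ` Pow (lists \<Omega>)" if "\<sigma> \<in> lists \<Omega>" for \<sigma>
      by (rule image_eqI[of _ _ "{\<sigma>}"]) (use that in \<open>simp_all add: cylinder_singleton\<close>)
    moreover have "{} \<in> cylinder \<Omega> ` Pow (lists \<Omega>)"
      by (rule image_eqI[of _ _ "{}"]) (auto simp: cylinder_def)
    ultimately show ?thesis by blast
  qed
  then show "sets (bernoulli_measure \<Omega> P) \<subseteq> sigma_sets (streams \<Omega>) (cylinder \<Omega> ` Pow (lists \<Omega>))"
    unfolding sets_bernoulli_measure_sstart by (rule sigma_sets_mono')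
next
  have "cylinder \<Omega> S \<in> sets (bernoulli_measure \<Omega> P)" if "S \<subseteq> lists \<Omega>" for S
  proof -
    have "cylinder \<Omega> {\<sigma>} \<in> sets (bernoulli_measure \<Omega> P)" if "\<sigma> \<in> S" for \<sigma>
    proof -
      have "\<sigma> \<in> lists \<Omega>" using that \<open>S \<subseteq> lists \<Omega>\<close> by blast
      then show ?thesis
        unfolding sets_bernoulli_measure_sstart
        by (subst cylinder_singleton) auto
    qed
    then show ?thesis
      by (subst cylinder_Union) (auto intro!: sets.countable_UN')
  qed
  then show "sigma_sets (streams \<Omega>) (cylinder \<Omega> ` Pow (lists \<Omega>)) \<subseteq> sets (bernoulli_measure \<Omega> P)"
    unfolding space_bernoulli_measure[of \<Omega> P, symmetric]
    by (intro sets.sigma_sets_subset) auto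
qed

lemma emeasure_bernoulli_measure_cylinder:
  assumes P: "P \<in> prob_spaces \<Omega>" and "\<sigma> \<in> lists \<Omega>"
  shows "emeasure (bernoulli_measure \<Omega> P) (cylinder \<Omega> {\<sigma>}) = ennreal (\<Prod>a\<leftarrow>\<sigma>. P a)"
  using \<open>\<sigma> \<in> lists \<Omega>\<close>
proof (induction \<sigma> rule: list.induct)
  case Nil
  interpret prob_space "bernoulli_measure \<Omega> P"
    by (rule prob_space_bernoulli_measure[OF P])
  show ?case
    using emeasure_space_1 by (simp add: cylinder_singleton space_bernoulli_measure)
next
  case (Cons x \<sigma>)
  let ?M = "point_measure \<Omega> (\<lambda>a. ennreal (P a))"
  have x: "x \<in> \<Omega>" and \<sigma>: "\<sigma> \<in> lists \<Omega>" using Cons.prems by auto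
  interpret prob_space ?M by (rule prob_space_point_measure[OF P])
  have nonneg: "\<And>a. a \<in> \<Omega> \<Longrightarrow> 0 \<le> P a"
    using P by (auto simp: prob_spaces_def)
  have sets: "sstart \<Omega> (x # \<sigma>) \<in> sets (stream_space ?M)"
    using sets_bernoulli_measure_sstart[of \<Omega> P] Cons.prems
    unfolding bernoulli_measure_def by auto
  have slice: "{s \<in> space (stream_space ?M). t ## s \<in> sstart \<Omega> (x # \<sigma>)} =
      (if t = x then sstart \<Omega> \<sigma> else {})" for t
    using sstart_in_streams[OF \<sigma>] by (auto simp: space_stream_space space_point_measure)
  have "emeasure (stream_space ?M) (sstart \<Omega> (x # \<sigma>)) =
      (\<integral>\<^sup>+t. emeasure (stream_space ?M) (sstart \<Omega> \<sigma>) * indicator {x} t \<partial>?M)"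
    unfolding emeasure_stream_space[OF sets] slice
    by (intro nn_integral_cong) (simp split: split_indicator)
  also have "\<dots> = emeasure (stream_space ?M) (sstart \<Omega> \<sigma>) * emeasure ?M {x}"
    using x by (subst nn_integral_cmult_indicator) (auto simp: sets_point_measure)
  also have "emeasure ?M {x} = ennreal (P x)"
    using x by (subst emeasure_point_measure_finite2) auto
  also have "emeasure (stream_space ?M) (sstart \<Omega> \<sigma>) = ennreal (\<Prod>a\<leftarrow>\<sigma>. P a)"
    using Cons.IH \<sigma> by (simp add: cylinder_singleton bernoulli_measure_def)
  finally show ?case
    using nonneg[OF x] Cons.prems
    by (simp add: cylinder_singleton bernoulli_measure_def mult.commute ennreal_mult')
qed


section \<open>Ensembles\<close>

definition prefix_free :: "nat list set \<Rightarrow> bool" where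
  "prefix_free S \<longleftrightarrow> (\<forall>\<sigma>\<in>S. \<forall>\<tau>\<in>S. prefix \<sigma> \<tau> \<longrightarrow> \<sigma> = \<tau>)"

definition re_string_relation :: "(nat \<times> nat list) set \<Rightarrow> bool" where
  "re_string_relation C \<longleftrightarrow> re_set ((\<lambda>(n, \<sigma>). prod_encode (n, list_encode \<sigma>)) ` C)"

definition martin_loef_test :: "nat set \<Rightarrow> (nat \<Rightarrow> real) \<Rightarrow> (nat \<times> nat list) set \<Rightarrow> bool" where
  "martin_loef_test \<Omega> P C \<longleftrightarrow>
     C \<subseteq> {1..} \<times> lists \<Omega> \<and> re_string_relation C \<and>
     (\<forall>n\<ge>1. prefix_free (C `` {n}) \<and>
        measure (bernoulli_measure \<Omega> P) (cylinder \<Omega> (C `` {n})) < (1 / 2) ^ n)"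

definition ensemble :: "nat set \<Rightarrow> (nat \<Rightarrow> real) \<Rightarrow> nat stream \<Rightarrow> bool" where
  "ensemble \<Omega> P \<alpha> \<longleftrightarrow> \<alpha> \<in> streams \<Omega> \<and>
     (\<forall>C. martin_loef_test \<Omega> P C \<longrightarrow> (\<exists>n\<ge>1. \<alpha> \<notin> cylinder \<Omega> (C `` {n})))"

definition equivalent_over :: "nat set \<Rightarrow> nat stream \<Rightarrow> nat stream \<Rightarrow> bool" where
  "equivalent_over \<Theta> \<gamma> \<delta> \<longleftrightarrow> (\<exists>Q\<in>prob_spaces \<Theta>. ensemble \<Theta> Q \<gamma> \<and> ensemble \<Theta> Q \<delta>)"


section \<open>Operations on sequences\<close>

definition char_seq :: "nat set \<Rightarrow> nat stream \<Rightarrow> nat stream" where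
  "char_seq A \<gamma> = smap (\<lambda>a. of_bool (a \<in> A)) \<gamma>"

text \<open>
  \<^const>\<open>sfilter\<close> is meaningful only for sequences with infinitely many elements in \<open>B\<close>. This
  holds for every ensemble for \<open>P\<close> if the event \<open>B\<close> is recursive and has positive probability.
\<close>

definition filtered :: "nat set \<Rightarrow> nat stream \<Rightarrow> nat stream" where
  "filtered B \<alpha> = sfilter (\<lambda>a. a \<in> B) \<alpha>"

end

theory Submission
  imports Defs
begin

text \<open>
  For a recursive event \<open>A\<close>, reading an ensemble for \<open>P\<close> through the indicator of \<open>A\<close> gives an
  ensemble over \<open>{0, 1}\<close> for the Bernoulli space with success probability \<open>P(A)\<close>; reading only the
  letters in \<open>B\<close> and then the indicator of \<open>A \<inter> B\<close> gives one for the success probability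
  \<open>P(A \<inter> B) / P(B)\<close>. A binary sequence is an ensemble for at most one success probability. So for
  every single ensemble \<open>\<alpha>\<close> the two sequences are equivalent exactly if
  \<open>P(A) = P(A \<inter> B) / P(B)\<close>, that is, if \<open>A\<close> and \<open>B\<close> are independent; as ensembles exist, "for all"
  and "there is" agree.

  Both ways of reading are instances of \<open>ensemble_char_seq_filtered\<close>. A test that catches the bit
  sequence is pulled back to strings over \<open>\<Omega>\<close>: a string is put into the new test if it is empty or
  ends in a letter of \<open>B\<close>, and its bits form a string of the old test. The end condition keeps the
  test prefix-free. The pulled-back test has the same measure, because the measure of the set of
  sequences whose bits begin with \<open>x w\<close> satisfies a linear equation obtained from the first letter: outside \<open>B\<close> one
  is back at the start, and inside \<open>B\<close> one needs the right bit and then \<open>w\<close>.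

  That the success probability is determined rests on one half of the law of large numbers
  (\<open>eventually_few_ones\<close>): if the success probability lies below a rational \<open>a / b\<close>, then in an
  ensemble the frequency of ones is eventually below \<open>a / b\<close>. The test consists of the strings that
  are the first among their prefixes of length at least \<open>c n\<close> to violate the bound. It is recursive
  because \<open>a / b\<close> is rational, although \<open>P\<close> itself need not be computable. Its measure is estimated
  by exponential tilting: on such strings the given measure is at most \<open>\<rho> ^ length\<close> times another
  Bernoulli measure, with \<open>\<rho> < 1\<close>, and the other measure of the test is at most 1. Applied to an
  event and to its complement, the law rules out two different success probabilities; applied to
  the complement of \<open>B\<close>, it shows that an ensemble meets \<open>B\<close> infinitely often, so that filtering
  is meaningful.

  Ensembles exist since there are only countably many tests and each catches a null set only.
\<close>

section \<open>Recursive functions of several arguments\<close>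

text \<open>
  The functions that agree with one in \<^const>\<open>recursive_nary\<close> on all argument lists of length \<open>n\<close>.
  Unlike \<^const>\<open>recursive_nary\<close> itself, this class does not depend on how a function treats lists of
  other lengths, so functions may be written in any convenient form.
\<close>

definition rec_op :: "nat \<Rightarrow> (nat list \<Rightarrow> nat) \<Rightarrow> bool" where
  "rec_op n f \<longleftrightarrow> (\<exists>F. recursive_nary n F \<and> (\<forall>xs. length xs = n \<longrightarrow> f xs = F xs))"

definition recursive_fun2 :: "(nat \<Rightarrow> nat \<Rightarrow> nat) \<Rightarrow> bool" where
  "recursive_fun2 h \<longleftrightarrow> rec_op 2 (\<lambda>xs. h (xs ! 0) (xs ! 1))"

lemma rec_op_cong:
  "rec_op n f \<Longrightarrow> (\<And>xs. length xs = n \<Longrightarrow> g xs = f xs) \<Longrightarrow> rec_op n g"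
  unfolding rec_op_def by auto

lemma rec_op_nth: "i < n \<Longrightarrow> rec_op n (\<lambda>xs. xs ! i)"
  unfolding rec_op_def using recursive_nary.Proj by blast

lemma rec_op_comp:
  assumes f: "rec_op (length gs) f" and gs: "\<forall>g\<in>set gs. rec_op n g"
  shows "rec_op n (\<lambda>xs. f (map (\<lambda>g. g xs) gs))"
proof -
  obtain F where F: "recursive_nary (length gs) F" "\<And>xs. length xs = length gs \<Longrightarrow> f xs = F xs"
    using f unfolding rec_op_def by blast
  obtain \<Phi> where \<Phi>: "\<forall>g\<in>set gs. recursive_nary n (\<Phi> g) \<and> (\<forall>xs. length xs = n \<longrightarrow> g xs = \<Phi> g xs)"
    using gs unfolding rec_op_def by metis
  have "recursive_nary n (\<lambda>xs. F (map (\<lambda>g. g xs) (map \<Phi> gs)))"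
    by (rule recursive_nary.Comp) (use F \<Phi> in auto)
  moreover have "f (map (\<lambda>g. g xs) gs) = F (map (\<lambda>g. g xs) (map \<Phi> gs))" if "length xs = n" for xs
  proof -
    have "map (\<lambda>g. g xs) gs = map (\<lambda>g. g xs) (map \<Phi> gs)"
      using \<Phi> that by simp
    then show ?thesis using F(2)[of "map (\<lambda>g. g xs) gs"] by (simp only: length_map)
  qed
  ultimately show ?thesis unfolding rec_op_def by blast
qed

lemma rec_op_prec:
  assumes "rec_op n f" "rec_op (Suc (Suc n)) g"
  shows "rec_op (Suc n) (\<lambda>xs. rec_nat (f (tl xs)) (\<lambda>y r. g (y # r # tl xs)) (hd xs))"
proof -
  obtain F where F: "recursive_nary n F" "\<And>xs. length xs = n \<Longrightarrow> f xs = F xs"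
    using assms(1) unfolding rec_op_def by blast
  obtain G where G: "recursive_nary (Suc (Suc n)) G" "\<And>xs. length xs = Suc (Suc n) \<Longrightarrow> g xs = G xs"
    using assms(2) unfolding rec_op_def by blast
  show ?thesis
    unfolding rec_op_def
    by (rule exI, rule conjI, rule recursive_nary.Prec[OF F(1) G(1)]) (simp add: F(2) G(2))
qed

lemma rec_op_Least:
  assumes f: "rec_op (Suc n) f" and ex: "\<And>xs. length xs = n \<Longrightarrow> \<exists>y. f (y # xs) = 0"
  shows "rec_op n (\<lambda>xs. LEAST y. f (y # xs) = 0)"
proof -
  obtain F where F: "recursive_nary (Suc n) F" "\<And>xs. length xs = Suc n \<Longrightarrow> f xs = F xs"
    using f unfolding rec_op_def by blast
  have "recursive_nary n (\<lambda>xs. LEAST y. F (y # xs) = 0)"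
    by (rule recursive_nary.Mu[OF F(1)]) (use ex F(2) in force)
  then show ?thesis
    unfolding rec_op_def by (intro exI conjI) (auto simp: F(2))
qed

lemma recursive_fun_iff: "recursive_fun f \<longleftrightarrow> rec_op 1 (\<lambda>xs. f (xs ! 0))"
proof
  assume "recursive_fun f"
  then obtain F where F: "recursive_nary 1 F" "\<And>x. f x = F [x]"
    unfolding recursive_fun_def by blast
  have "f (xs ! 0) = F xs" if "length xs = 1" for xs
    using that F(2) by (cases xs) auto
  then show "rec_op 1 (\<lambda>xs. f (xs ! 0))" unfolding rec_op_def using F(1) by blast
next
  assume "rec_op 1 (\<lambda>xs. f (xs ! 0))"
  then obtain F where F: "recursive_nary 1 F" "\<And>xs. length xs = 1 \<Longrightarrow> f (xs ! 0) = F xs"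
    unfolding rec_op_def by blast
  have "f x = F [x]" for x using F(2)[of "[x]"] by simp
  then show "recursive_fun f" unfolding recursive_fun_def using F(1) by blast
qed

lemma rec_op_comp1:
  assumes "recursive_fun u" "rec_op n f"
  shows "rec_op n (\<lambda>xs. u (f xs))"
  using rec_op_comp[of "[f]" "\<lambda>xs. u (xs ! 0)" n] assms by (simp add: recursive_fun_iff)

lemma rec_op_comp2:
  assumes "recursive_fun2 h" "rec_op n f" "rec_op n g"
  shows "rec_op n (\<lambda>xs. h (f xs) (g xs))"
  using rec_op_comp[of "[f, g]" "\<lambda>xs. h (xs ! 0) (xs ! 1)" n] assms
  by (simp add: recursive_fun2_def numeral_2_eq_2)

lemma recursive_fun_comp: "recursive_fun u \<Longrightarrow> recursive_fun f \<Longrightarrow> recursive_fun (\<lambda>x. u (f x))"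
  using rec_op_comp1[of u 1 "\<lambda>xs. f (xs ! 0)"] recursive_fun_iff[of f] recursive_fun_iff[of "\<lambda>x. u (f x)"]
  by simp

lemma recursive_fun_comp2:
  "recursive_fun2 h \<Longrightarrow> recursive_fun f \<Longrightarrow> recursive_fun g \<Longrightarrow> recursive_fun (\<lambda>x. h (f x) (g x))"
  using rec_op_comp2[of h 1 "\<lambda>xs. f (xs ! 0)" "\<lambda>xs. g (xs ! 0)"] by (simp add: recursive_fun_iff)

lemma recursive_fun2_swap: "recursive_fun2 h \<Longrightarrow> recursive_fun2 (\<lambda>x y. h y x)"
  unfolding recursive_fun2_def[of "\<lambda>x y. h y x"]
  by (rule rec_op_comp2[of h 2 "\<lambda>xs. xs ! 1" "\<lambda>xs. xs ! 0"]) (simp_all add: rec_op_nth)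

lemma recursive_fun_id: "recursive_fun (\<lambda>x. x)"
  unfolding recursive_fun_iff by (rule rec_op_nth) simp

lemma recursive_fun_Suc: "recursive_fun Suc"
  unfolding recursive_fun_def using recursive_nary.Succ by force

lemma recursive_fun_const: "recursive_fun (\<lambda>x. c)"
proof (induction c)
  case 0
  show ?case unfolding recursive_fun_def using recursive_nary.Zero by force
next
  case (Suc c)
  show ?case by (rule recursive_fun_comp[OF recursive_fun_Suc Suc.IH])
qed

lemma recursive_fun2_rec_nat:
  assumes "recursive_fun u" "rec_op 3 (\<lambda>xs. v (xs ! 0) (xs ! 1) (xs ! 2))"
  shows "recursive_fun2 (\<lambda>n x. rec_nat (u x) (\<lambda>y r. v y r x) n)"
proof -
  have "rec_op (Suc 1) (\<lambda>xs. rec_nat (u (tl xs ! 0))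
      (\<lambda>y r. (\<lambda>xs. v (xs ! 0) (xs ! 1) (xs ! 2)) (y # r # tl xs)) (hd xs))"
    using assms by (intro rec_op_prec) (simp_all add: recursive_fun_iff numeral_3_eq_3)
  then show ?thesis
    unfolding recursive_fun2_def numeral_2_eq_2 One_nat_def
    by (rule rec_op_cong) (auto simp: length_Suc_conv numeral_2_eq_2)
qed

lemma recursive_fun2_add: "recursive_fun2 (+)"
proof -
  have "recursive_fun2 (\<lambda>n x. rec_nat x (\<lambda>y r. Suc r) n)"
    by (intro recursive_fun2_rec_nat recursive_fun_id rec_op_comp1[OF recursive_fun_Suc] rec_op_nth) auto
  moreover have "rec_nat x (\<lambda>y r. Suc r) n = n + x" for n x by (induction n) auto
  ultimately show ?thesis by simp
qed

lemma recursive_fun2_mult: "recursive_fun2 (*)"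
proof -
  have "recursive_fun2 (\<lambda>n x. rec_nat 0 (\<lambda>y r. r + x) n)"
    by (intro recursive_fun2_rec_nat recursive_fun_const rec_op_comp2[OF recursive_fun2_add] rec_op_nth) auto
  moreover have "rec_nat 0 (\<lambda>y r. r + x) n = n * x" for n x :: nat by (induction n) auto
  ultimately show ?thesis by simp
qed

lemma recursive_fun_pred: "recursive_fun (\<lambda>n. n - 1)"
proof -
  have "recursive_fun2 (\<lambda>n x. rec_nat 0 (\<lambda>y r. y) n)"
    by (intro recursive_fun2_rec_nat recursive_fun_const rec_op_nth) auto
  then have "recursive_fun (\<lambda>n. rec_nat 0 (\<lambda>y r. y) n)"
    by (rule recursive_fun_comp2) (rule recursive_fun_id)+
  moreover have "rec_nat 0 (\<lambda>y r. y) n = n - 1" for n :: nat by (induction n) auto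
  ultimately show ?thesis by simp
qed

lemma recursive_fun2_diff: "recursive_fun2 (-)"
proof -
  have "recursive_fun2 (\<lambda>n x. rec_nat x (\<lambda>y r. r - 1) n)"
    by (intro recursive_fun2_rec_nat recursive_fun_id rec_op_comp1[OF recursive_fun_pred] rec_op_nth) auto
  moreover have "rec_nat x (\<lambda>y r. r - 1) n = x - n" for n x :: nat by (induction n) auto
  ultimately have "recursive_fun2 (\<lambda>n x. x - n)" by simp
  then show ?thesis by (rule recursive_fun2_swap)
qed

lemma recursive_fun_triangle: "recursive_fun triangle"
proof -
  have "recursive_fun2 (\<lambda>n x. rec_nat 0 (\<lambda>y r. r + Suc y) n)"
    by (intro recursive_fun2_rec_nat recursive_fun_const rec_op_comp2[OF recursive_fun2_add]
        rec_op_comp1[OF recursive_fun_Suc] rec_op_nth) auto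
  then have "recursive_fun (\<lambda>n. rec_nat 0 (\<lambda>y r. r + Suc y) n)"
    by (rule recursive_fun_comp2) (rule recursive_fun_id)+
  moreover have "rec_nat 0 (\<lambda>y r. r + Suc y) n = triangle n" for n by (induction n) auto
  ultimately show ?thesis by simp
qed


section \<open>Recursive functions on coded pairs and lists\<close>

abbreviation pfst :: "nat \<Rightarrow> nat" where "pfst z \<equiv> fst (prod_decode z)"
abbreviation psnd :: "nat \<Rightarrow> nat" where "psnd z \<equiv> snd (prod_decode z)"
abbreviation pair :: "nat \<Rightarrow> nat \<Rightarrow> nat" where "pair x y \<equiv> prod_encode (x, y)"

lemma recursive_fun2_pair: "recursive_fun2 pair"
  unfolding recursive_fun2_def prod_encode_def split
  by (intro rec_op_comp2[OF recursive_fun2_add] rec_op_comp1[OF recursive_fun_triangle] rec_op_nth) auto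

text \<open>
  The code of \<open>(m, n)\<close> is \<open>triangle (m + n) + m\<close>, so \<open>m + n\<close> is the index of the last triangular number
  that does not exceed the code. This is how unbounded search decodes pairs.
\<close>

lemma Least_triangle: "(LEAST k. Suc z - triangle (Suc k) = 0) = pfst z + psnd z"
proof -
  obtain m n where z: "z = prod_encode (m, n)" by (metis prod_decode_inverse surj_pair)
  have mono: "triangle i \<le> triangle j" if "i \<le> j" for i j
    using that by (induction rule: dec_induct) auto
  show ?thesis
  proof (rule Least_equality)
    show "Suc z - triangle (Suc (pfst z + psnd z)) = 0"
      by (simp only: z prod_encode_inverse fst_conv snd_conv) (simp add: prod_encode_def)
  next
    fix k assume k: "Suc z - triangle (Suc k) = 0"
    show "pfst z + psnd z \<le> k"
    proof (rule ccontr)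
      assume "\<not> pfst z + psnd z \<le> k"
      then have "triangle (Suc k) \<le> triangle (m + n)" by (intro mono) (simp add: z)
      then have "triangle (Suc k) \<le> z" by (simp only: z prod_encode_def split)
      then show False using k by simp
    qed
  qed
qed

lemma recursive_fun_pfst_plus_psnd: "recursive_fun (\<lambda>z. pfst z + psnd z)"
proof -
  have "rec_op 1 (\<lambda>xs. LEAST k. (\<lambda>ys. Suc (ys ! 1) - triangle (Suc (ys ! 0))) (k # xs) = 0)"
  proof (rule rec_op_Least)
    show "rec_op (Suc 1) (\<lambda>ys. Suc (ys ! 1) - triangle (Suc (ys ! 0)))"
      by (intro rec_op_comp2[OF recursive_fun2_diff] rec_op_comp1[OF recursive_fun_triangle]
          rec_op_comp1[OF recursive_fun_Suc] rec_op_nth) auto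
    fix xs :: "nat list"
    have "n \<le> triangle n" for n by (induction n) auto
    from this[of "Suc (xs ! 0)"] show "\<exists>y. Suc ((y # xs) ! 1) - triangle (Suc ((y # xs) ! 0)) = 0"
      by (intro exI[of _ "xs ! 0"]) simp
  qed
  then show ?thesis
    unfolding recursive_fun_iff by (simp only: Least_triangle nth_Cons_0 One_nat_def nth_Cons_Suc)
qed

lemma recursive_fun_pfst: "recursive_fun pfst"
proof -
  have "pfst z = z - triangle (pfst z + psnd z)" for z
    by (subst (2) prod_decode_inverse[symmetric], cases "prod_decode z") (simp add: prod_encode_def)
  moreover have "recursive_fun (\<lambda>z. z - triangle (pfst z + psnd z))"
    by (intro recursive_fun_comp2[OF recursive_fun2_diff] recursive_fun_id
        recursive_fun_comp[OF recursive_fun_triangle] recursive_fun_pfst_plus_psnd)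
  ultimately show ?thesis by simp
qed

lemma recursive_fun_psnd: "recursive_fun psnd"
proof -
  have "recursive_fun (\<lambda>z. (pfst z + psnd z) - pfst z)"
    by (intro recursive_fun_comp2[OF recursive_fun2_diff] recursive_fun_pfst_plus_psnd recursive_fun_pfst)
  then show ?thesis by simp
qed

definition recursive_pred :: "(nat \<Rightarrow> bool) \<Rightarrow> bool" where
  "recursive_pred p \<longleftrightarrow> recursive_fun (\<lambda>x. of_bool (p x))"

lemma recursive_fun_if:
  assumes p: "recursive_pred p" and f: "recursive_fun f" and g: "recursive_fun g"
  shows "recursive_fun (\<lambda>x. if p x then f x else g x)"
proof -
  have "recursive_fun (\<lambda>x. of_bool (p x) * f x + (1 - of_bool (p x)) * g x)"
    by (intro recursive_fun_comp2[OF recursive_fun2_add] recursive_fun_comp2[OF recursive_fun2_mult]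
        recursive_fun_comp2[OF recursive_fun2_diff] recursive_fun_const
        p[unfolded recursive_pred_def] f g)
  moreover have "of_bool (p x) * f x + (1 - of_bool (p x)) * g x = (if p x then f x else g x)" for x
    by simp
  ultimately show ?thesis by simp
qed

lemma recursive_pred_not:
  assumes "recursive_pred p"
  shows "recursive_pred (\<lambda>x. \<not> p x)"
proof -
  have "recursive_fun (\<lambda>x. 1 - of_bool (p x))"
    using assms unfolding recursive_pred_def
    by (intro recursive_fun_comp2[OF recursive_fun2_diff] recursive_fun_const)
  moreover have "1 - of_bool (p x) = (of_bool (\<not> p x) :: nat)" for x by simp
  ultimately show ?thesis by (simp add: recursive_pred_def del: of_bool_not_iff)
qed

lemma recursive_pred_conj:
  assumes "recursive_pred p" "recursive_pred q"
  shows "recursive_pred (\<lambda>x. p x \<and> q x)"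
proof -
  have "recursive_fun (\<lambda>x. of_bool (p x) * of_bool (q x))"
    using assms unfolding recursive_pred_def by (rule recursive_fun_comp2[OF recursive_fun2_mult])
  then show ?thesis by (simp add: recursive_pred_def of_bool_conj)
qed

lemma recursive_pred_le:
  assumes "recursive_fun f" "recursive_fun g"
  shows "recursive_pred (\<lambda>x. f x \<le> g x)"
proof -
  have "recursive_fun (\<lambda>x. 1 - (f x - g x))"
    using assms by (intro recursive_fun_comp2[OF recursive_fun2_diff] recursive_fun_const)
  moreover have "1 - (f x - g x) = of_bool (f x \<le> g x)" for x by simp
  ultimately show ?thesis by (simp add: recursive_pred_def)
qed

lemma recursive_pred_eq:
  assumes "recursive_fun f" "recursive_fun g"
  shows "recursive_pred (\<lambda>x. f x = g x)"
  using recursive_pred_conj[OF recursive_pred_le[OF assms] recursive_pred_le[OF assms(2,1)]]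
  by (simp add: eq_iff)

lemma recursive_pred_mem:
  "recursive_set A \<Longrightarrow> recursive_fun f \<Longrightarrow> recursive_pred (\<lambda>x. f x \<in> A)"
  unfolding recursive_set_def recursive_pred_def
  by (rule recursive_fun_comp[of "\<lambda>x. of_bool (x \<in> A)"])

lemma recursive_fun_of_bool: "recursive_pred p \<Longrightarrow> recursive_fun (\<lambda>x. of_bool (p x))"
  by (simp add: recursive_pred_def)

text \<open>
  Rules in the form \<open>\<lambda>x. \<dots>\<close>, so that a term built from the listed operations is recognized as recursive
  by following its syntax.
\<close>

lemmas recursive_intros =
  recursive_fun_id recursive_fun_const recursive_fun_comp[OF recursive_fun_Suc]
  recursive_fun_comp2[OF recursive_fun2_add] recursive_fun_comp2[OF recursive_fun2_mult]
  recursive_fun_comp2[OF recursive_fun2_diff] recursive_fun_comp2[OF recursive_fun2_pair]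
  recursive_fun_comp[OF recursive_fun_pfst] recursive_fun_comp[OF recursive_fun_psnd]
  recursive_fun_if recursive_fun_of_bool
  recursive_pred_not recursive_pred_conj recursive_pred_le recursive_pred_eq recursive_pred_mem

lemma recursive_fun_funpow:
  assumes s: "recursive_fun s" and n: "recursive_fun n" and a: "recursive_fun a"
  shows "recursive_fun (\<lambda>x. (s ^^ n x) (a x))"
proof -
  have "recursive_fun2 (\<lambda>n x. rec_nat x (\<lambda>y r. s r) n)"
    by (intro recursive_fun2_rec_nat recursive_fun_id rec_op_comp1[OF s] rec_op_nth) auto
  moreover have "rec_nat x (\<lambda>y r. s r) n = (s ^^ n) x" for n x by (induction n) auto
  ultimately have "recursive_fun2 (\<lambda>n x. (s ^^ n) x)" by simp
  then show ?thesis using n a by (rule recursive_fun_comp2)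
qed

lemma length_le_list_encode: "length xs \<le> list_encode xs"
proof (induction xs)
  case (Cons x xs)
  have "list_encode xs \<le> pair x (list_encode xs)" by (rule le_prod_encode_2)
  with Cons show ?case by simp
qed simp

text \<open>
  Every list function below is a left fold. The fold is run as an iteration of one step on the coded pair
  of the remaining list and the accumulator.
\<close>

lemma recursive_fun_fold:
  assumes s: "recursive_fun (\<lambda>z. s (pfst z) (psnd z))" and l: "recursive_fun l" and a: "recursive_fun a"
  shows "recursive_fun (\<lambda>x. fold s (list_decode (l x)) (a x))"
proof -
  define t where "t z = (if pfst z = 0 then z
      else pair (psnd (pfst z - 1)) (s (pfst (pfst z - 1)) (psnd z)))" for z
  have "recursive_fun (\<lambda>z. s (pfst (pair (pfst (pfst z - 1)) (psnd z)))
                             (psnd (pair (pfst (pfst z - 1)) (psnd z))))"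
    by (rule recursive_fun_comp[OF s]) (intro recursive_intros)
  then have t: "recursive_fun t"
    unfolding t_def by (intro recursive_intros) simp
  have fixed: "(t ^^ n) (pair 0 y) = pair 0 y" for n y
    by (induction n) (simp_all add: t_def)
  \<comment> \<open>The step does nothing once the list is empty, so too many iterations do no harm. The code of the
     list bounds its length and serves as the number of iterations.\<close>
  have fold: "psnd ((t ^^ n) (pair (list_encode xs) y)) = fold s xs y" if "length xs \<le> n" for n xs y
    using that
  proof (induction xs arbitrary: n y)
    case Nil
    show ?case by (simp add: fixed)
  next
    case (Cons x xs)
    then obtain m where n: "n = Suc m" and "length xs \<le> m" by (cases n) auto
    moreover have "t (pair (list_encode (x # xs)) y) = pair (list_encode xs) (s x y)"
      by (simp add: t_def)
    ultimately show ?case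
      using Cons.IH[of m "s x y"] by (simp only: n funpow_Suc_right o_apply fold_simps)
  qed
  have "fold s (list_decode k) y = psnd ((t ^^ k) (pair k y))" for k y
    using fold[of "list_decode k" k y] length_le_list_encode[of "list_decode k"] by simp
  moreover have "recursive_fun (\<lambda>x. psnd ((t ^^ l x) (pair (l x) (a x))))"
    by (intro recursive_intros recursive_fun_funpow t l a)
  ultimately show ?thesis by simp
qed

lemma recursive_fun_rev:
  assumes l: "recursive_fun l"
  shows "recursive_fun (\<lambda>x. list_encode (rev (list_decode (l x))))"
proof -
  have "fold (\<lambda>x k. Suc (pair x k)) xs (list_encode ys) = list_encode (rev xs @ ys)" for xs ys
    by (induction xs arbitrary: ys) (simp_all del: list_encode.simps(2) add: list_encode.simps(2)[symmetric])
  from this[where ys = "[]"]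
  have "list_encode (rev xs) = fold (\<lambda>x k. Suc (pair x k)) xs 0" for xs by simp
  moreover have "recursive_fun (\<lambda>x. fold (\<lambda>x k. Suc (pair x k)) (list_decode (l x)) 0)"
    by (intro recursive_fun_fold recursive_intros l)
  ultimately show ?thesis by simp
qed

lemma recursive_fun_map_filter:
  assumes p: "recursive_pred p" and f: "recursive_fun f" and l: "recursive_fun l"
  shows "recursive_fun (\<lambda>x. list_encode (map f (filter p (list_decode (l x)))))"
proof -
  define s where "s x k = (if p x then Suc (pair (f x) k) else k)" for x k
  have *: "fold s xs (list_encode ys) = list_encode (rev (map f (filter p xs)) @ ys)" for xs ys
    by (induction xs arbitrary: ys)
      (simp_all del: list_encode.simps(2) add: s_def list_encode.simps(2)[symmetric])
  have eq: "list_encode (map f (filter p xs)) = list_encode (rev (list_decode (fold s xs 0)))" for xs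
    using *[of xs "[]"] by simp
  have "recursive_fun (\<lambda>z. f (pfst z))" "recursive_pred (\<lambda>z. p (pfst z))"
    using recursive_fun_comp[OF f recursive_fun_pfst]
      recursive_fun_comp[OF p[unfolded recursive_pred_def] recursive_fun_pfst]
    by (simp_all add: recursive_pred_def)
  then have "recursive_fun (\<lambda>z. s (pfst z) (psnd z))"
    unfolding s_def by (intro recursive_intros)
  then have "recursive_fun (\<lambda>x. list_encode (rev (list_decode (fold s (list_decode (l x)) 0))))"
    by (intro recursive_fun_rev recursive_fun_fold recursive_intros l)
  then show ?thesis by (simp only: eq)
qed

lemma recursive_pred_True: "recursive_pred (\<lambda>x. True)"
  by (simp add: recursive_pred_def recursive_fun_const)

lemma recursive_fun_map:
  assumes "recursive_fun f" "recursive_fun l"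
  shows "recursive_fun (\<lambda>x. list_encode (map f (list_decode (l x))))"
  using recursive_fun_map_filter[OF recursive_pred_True assms] by simp

lemma recursive_pred_last:
  assumes B: "recursive_set B" and l: "recursive_fun l"
  shows "recursive_pred (\<lambda>x. list_decode (l x) = [] \<or> last (list_decode (l x)) \<in> B)"
proof -
  have "fold (\<lambda>a k. of_bool (a \<in> B)) xs (1 :: nat) = of_bool (xs = [] \<or> last xs \<in> B)" for xs
    by (induction xs rule: rev_induct) auto
  moreover have "recursive_fun (\<lambda>x. fold (\<lambda>a k. of_bool (a \<in> B)) (list_decode (l x)) 1)"
    by (intro recursive_fun_fold recursive_intros l recursive_pred_mem[OF B])
  ultimately show ?thesis by (simp add: recursive_pred_def)
qed

lemma recursive_set_Compl: "recursive_set A \<Longrightarrow> recursive_set (- A)"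
  using recursive_pred_not[of "\<lambda>x. x \<in> A"] by (simp add: recursive_set_def recursive_pred_def)

lemma recursive_set_Int: "recursive_set A \<Longrightarrow> recursive_set B \<Longrightarrow> recursive_set (A \<inter> B)"
  using recursive_pred_conj[of "\<lambda>x. x \<in> A" "\<lambda>x. x \<in> B"]
  by (simp add: recursive_set_def recursive_pred_def)

text \<open>
  All r.e. sets below arise in this form: the outputs of a recursive function on the inputs that pass a
  recursive check. Inputs that fail are sent to a fixed output of an input that passes.
\<close>

lemma re_set_image_Collect:
  assumes e: "recursive_fun e" and p: "recursive_pred p"
  shows "re_set (e ` {x. p x})"
proof (cases "\<exists>x. p x")
  case True
  then obtain d where d: "p d" by blast
  have "recursive_fun (\<lambda>x. if p x then e x else e d)"
    by (intro recursive_intros p e)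
  moreover have "e ` {x. p x} = range (\<lambda>x. if p x then e x else e d)"
    using d by auto
  ultimately show ?thesis unfolding re_set_def by blast
qed (simp add: re_set_def)

lemma re_set_binary: "re_set {0, 1}"
proof -
  have "re_set ((\<lambda>x. x) ` {x. x \<le> 1})"
    by (intro re_set_image_Collect recursive_intros)
  moreover have "{x. x \<le> 1} = {0, 1 :: nat}" by auto
  ultimately show ?thesis by simp
qed

abbreviation encode_pair :: "nat \<times> nat list \<Rightarrow> nat" where
  "encode_pair \<equiv> \<lambda>(n, \<sigma>). prod_encode (n, list_encode \<sigma>)"


section \<open>Existence of ensembles\<close>

text \<open>
  Programs for the functions in \<^const>\<open>recursive_nary\<close>. Being finite objects, they are countable in
  number, and so are the r.e. sets.
\<close>

datatype recursive_term = ZeroT | SuccT | ProjT nat | CompT recursive_term "recursive_term list"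
  | PrecT recursive_term recursive_term | MuT recursive_term

instance recursive_term :: countable
  by countable_datatype

primrec interpret_term :: "recursive_term \<Rightarrow> nat list \<Rightarrow> nat" where
  "interpret_term ZeroT = (\<lambda>xs. 0)"
| "interpret_term SuccT = (\<lambda>xs. Suc (xs ! 0))"
| "interpret_term (ProjT i) = (\<lambda>xs. xs ! i)"
| "interpret_term (CompT f gs) = (\<lambda>xs. interpret_term f (map (\<lambda>g. g xs) (map interpret_term gs)))"
| "interpret_term (PrecT f g) = (\<lambda>xs. rec_nat (interpret_term f (tl xs))
     (\<lambda>y r. interpret_term g (y # r # tl xs)) (hd xs))"
| "interpret_term (MuT f) = (\<lambda>xs. LEAST y. interpret_term f (y # xs) = 0)"

lemma recursive_nary_interpret_term: "recursive_nary n f \<Longrightarrow> f \<in> range interpret_term"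
proof (induction rule: recursive_nary.induct)
  case (Zero n)
  show ?case by (rule range_eqI[of _ _ ZeroT]) simp
next
  case Succ
  show ?case by (rule range_eqI[of _ _ SuccT]) simp
next
  case (Proj i n)
  show ?case by (rule range_eqI[of _ _ "ProjT i"]) simp
next
  case (Comp gs f n)
  then obtain t where t: "f = interpret_term t" by blast
  have "\<forall>g\<in>set gs. \<exists>s. g = interpret_term s"
    using Comp by blast
  then obtain \<Phi> where \<Phi>: "\<forall>g\<in>set gs. g = interpret_term (\<Phi> g)" by metis
  have gs: "gs = map interpret_term (map \<Phi> gs)"
    using \<Phi> by (simp add: map_idI)
  show ?case
    by (rule range_eqI[of _ _ "CompT t (map \<Phi> gs)"]) (simp only: t interpret_term.simps gs[symmetric])
next
  case (Prec n f g)
  then obtain s t where "f = interpret_term s" "g = interpret_term t" by blast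
  then show ?case by (intro range_eqI[of _ _ "PrecT s t"]) simp
next
  case (Mu n f)
  then obtain t where "f = interpret_term t" by blast
  then show ?case by (intro range_eqI[of _ _ "MuT t"]) simp
qed

lemma countable_recursive_fun: "countable {f. recursive_fun f}"
proof (rule countable_subset)
  show "{f. recursive_fun f} \<subseteq> range (\<lambda>t x. interpret_term t [x])"
  proof
    fix f assume "f \<in> {f. recursive_fun f}"
    then obtain F where F: "recursive_nary 1 F" "\<And>x. f x = F [x]"
      unfolding recursive_fun_def by blast
    then obtain t where "F = interpret_term t" using recursive_nary_interpret_term by blast
    with F(2) have "f = (\<lambda>x. interpret_term t [x])" by (intro ext) simp
    then show "f \<in> range (\<lambda>t x. interpret_term t [x])" by blast
  qed
qed simp

lemma countable_re_set: "countable {A. re_set A}"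
proof (rule countable_subset)
  show "{A. re_set A} \<subseteq> insert {} (range ` {f. recursive_fun f})"
    by (auto simp: re_set_def)
qed (simp add: countable_recursive_fun)

lemma inj_encode_pair: "inj encode_pair"
  by (auto simp: inj_on_def list_encode_eq)

lemma countable_re_string_relation: "countable {C. re_string_relation C}"
proof (rule countable_image_inj_on)
  show "countable (image encode_pair ` {C. re_string_relation C})"
    by (rule countable_subset[OF _ countable_re_set]) (auto simp: re_string_relation_def)
  show "inj_on (image encode_pair) {C. re_string_relation C}"
    using inj_encode_pair by (auto simp: inj_on_def inj_image_eq_iff)
qed

lemma cylinder_in_sets: "S \<subseteq> lists \<Omega> \<Longrightarrow> cylinder \<Omega> S \<in> sets (bernoulli_measure \<Omega> P)"
  unfolding sets_bernoulli_measure by (intro sigma_sets.Basic) auto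

lemma test_section_subset: "martin_loef_test \<Omega> P C \<Longrightarrow> C `` {n} \<subseteq> lists \<Omega>"
  unfolding martin_loef_test_def by blast

text \<open>
  A sequence caught at every level of a test lies in sets of measure below \<open>2\<^sup>-\<^sup>n\<close> for every \<open>n\<close>.
\<close>

lemma test_null_set:
  assumes P: "P \<in> prob_spaces \<Omega>" and C: "martin_loef_test \<Omega> P C"
  shows "(\<Inter>n\<in>{1..}. cylinder \<Omega> (C `` {n})) \<in> null_sets (bernoulli_measure \<Omega> P)"
proof -
  let ?M = "bernoulli_measure \<Omega> P"
  interpret prob_space ?M by (rule prob_space_bernoulli_measure[OF P])
  have sets: "cylinder \<Omega> (C `` {n}) \<in> events" for n
    by (rule cylinder_in_sets[OF test_section_subset[OF C]])
  let ?N = "\<Inter>n\<in>{1..}. cylinder \<Omega> (C `` {n})"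
  have N: "?N \<in> events" using sets by (intro sets.countable_INT') auto
  have bound: "prob ?N \<le> (1 / 2) ^ n" if "n \<ge> 1" for n :: nat
  proof -
    have "prob ?N \<le> prob (cylinder \<Omega> (C `` {n}))"
      using that sets by (intro finite_measure_mono) auto
    also have "\<dots> \<le> (1 / 2) ^ n"
      using C that unfolding martin_loef_test_def by force
    finally show ?thesis .
  qed
  have "(\<lambda>n. (1 / 2 :: real) ^ n) \<longlonglongrightarrow> 0" by (rule LIMSEQ_power_zero) simp
  then have "prob ?N \<le> 0"
    by (rule LIMSEQ_le_const) (use bound in blast)
  then have "prob ?N = 0"
    using measure_nonneg by (rule antisym)
  with N show ?thesis
    by (intro null_setsI) (simp_all add: emeasure_eq_measure)
qed

theorem ensemble_exists:
  assumes P: "P \<in> prob_spaces \<Omega>"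
  shows "\<exists>\<alpha>. ensemble \<Omega> P \<alpha>"
proof -
  let ?M = "bernoulli_measure \<Omega> P"
  interpret prob_space ?M by (rule prob_space_bernoulli_measure[OF P])
  let ?N = "\<Union>C\<in>{C. martin_loef_test \<Omega> P C}. \<Inter>n\<in>{1..}. cylinder \<Omega> (C `` {n})"
  have "countable {C. martin_loef_test \<Omega> P C}"
    by (rule countable_subset[OF _ countable_re_string_relation]) (auto simp: martin_loef_test_def)
  then have "?N \<in> null_sets ?M"
    by (rule null_sets_UN') (use test_null_set[OF P] in blast)
  then have "space ?M - ?N \<noteq> {}"
    using emeasure_space_1 by (metis Diff_eq_empty_iff emeasure_mono null_setsD1 null_setsD2
        le_zero_eq zero_neq_one)
  then obtain \<alpha> where "\<alpha> \<in> streams \<Omega>" "\<alpha> \<notin> ?N"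
    unfolding space_bernoulli_measure by blast
  then have "ensemble \<Omega> P \<alpha>"
    unfolding ensemble_def by fastforce
  then show ?thesis ..
qed


section \<open>Probabilities of events and of prefix-free sets\<close>

text \<open>
  Through this identity event probabilities inherit their additivity from a measure.
\<close>

lemma measure_point_measure:
  assumes P: "P \<in> prob_spaces \<Omega>" and X: "X \<subseteq> \<Omega>"
  shows "measure (point_measure \<Omega> (\<lambda>a. ennreal (P a))) X = event_prob P X"
proof -
  have nonneg: "\<And>a. a \<in> X \<Longrightarrow> 0 \<le> P a" and summable: "P summable_on \<Omega>"
    using P X by (auto simp: prob_spaces_def dest: has_sum_imp_summable)
  have "P summable_on X" using summable X by (rule summable_on_subset_banach)
  then have abs: "Infinite_Set_Sum.abs_summable_on P X"
    unfolding abs_summable_equivalent[symmetric]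
    by (rule summable_on_iff_abs_summable_on_real[THEN iffD1])
  have "emeasure (point_measure \<Omega> (\<lambda>a. ennreal (P a))) X =
      (\<integral>\<^sup>+a. ennreal (P a) * indicator X a \<partial>count_space \<Omega>)"
    unfolding point_measure_def using X by (subst emeasure_density) auto
  also have "\<dots> = (\<integral>\<^sup>+a. ennreal (P a) \<partial>count_space X)"
    using X by (auto simp: nn_integral_count_space_indicator intro!: nn_integral_cong
        split: split_indicator)
  also have "\<dots> = ennreal (infsetsum P X)"
    by (rule nn_integral_conv_infsetsum) (use abs nonneg in auto)
  also have "infsetsum P X = event_prob P X"
    using abs by (simp add: infsetsum_infsum event_prob_def)
  finally show ?thesis
    using nonneg by (simp add: measure_def event_prob_def infsum_nonneg)
qed

lemma event_prob_nonneg: "P \<in> prob_spaces \<Omega> \<Longrightarrow> X \<subseteq> \<Omega> \<Longrightarrow> 0 \<le> event_prob P X"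
  by (metis measure_point_measure measure_nonneg)

lemma event_prob_Un_disjoint:
  assumes P: "P \<in> prob_spaces \<Omega>" and "X \<subseteq> \<Omega>" "Y \<subseteq> \<Omega>" "X \<inter> Y = {}"
  shows "event_prob P (X \<union> Y) = event_prob P X + event_prob P Y"
proof -
  interpret prob_space "point_measure \<Omega> (\<lambda>a. ennreal (P a))"
    by (rule prob_space_point_measure[OF P])
  show ?thesis
    using finite_measure_Union[of X Y] assms
    by (simp add: measure_point_measure[OF P] sets_point_measure)
qed

lemma event_prob_space: "P \<in> prob_spaces \<Omega> \<Longrightarrow> event_prob P \<Omega> = 1"
  by (simp add: prob_spaces_def event_prob_def infsumI)

lemma event_prob_Compl:
  assumes P: "P \<in> prob_spaces \<Omega>"
  shows "event_prob P (\<Omega> \<inter> - A) = 1 - event_prob P (\<Omega> \<inter> A)"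
proof -
  have "event_prob P ((\<Omega> \<inter> - A) \<union> (\<Omega> \<inter> A)) = event_prob P (\<Omega> \<inter> - A) + event_prob P (\<Omega> \<inter> A)"
    by (rule event_prob_Un_disjoint[OF P]) auto
  moreover have "(\<Omega> \<inter> - A) \<union> (\<Omega> \<inter> A) = \<Omega>" by blast
  ultimately show ?thesis using event_prob_space[OF P] by simp
qed

lemma prob_spaces_binary: "Q \<in> prob_spaces {0, 1} \<longleftrightarrow> 0 \<le> Q 0 \<and> 0 \<le> Q 1 \<and> Q 0 + Q 1 = 1"
  using has_sum_finite_iff[of "{0::nat, 1}" Q 1] by (auto simp: prob_spaces_def)

text \<open>
  Two prefixes of one sequence are comparable. Hence the cylinders of the strings in a prefix-free set are
  disjoint, and the measure of their union is a sum.
\<close>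

lemma prefix_free_stake_unique:
  assumes "prefix_free S" "stake m \<alpha> \<in> S" "stake n \<alpha> \<in> S"
  shows "stake m \<alpha> = stake n \<alpha>"
proof -
  have "prefix (stake i \<alpha>) (stake j \<alpha>)" if "i \<le> j" for i j
    using stake_add[of i \<alpha> "j - i"] that by (metis le_add_diff_inverse prefixI)
  then show ?thesis
    using assms unfolding prefix_free_def by (metis nat_le_linear)
qed

lemma emeasure_cylinder_prefix_free:
  assumes S: "S \<subseteq> lists \<Omega>" and pf: "prefix_free S"
  shows "emeasure (bernoulli_measure \<Omega> P) (cylinder \<Omega> S) =
    (\<integral>\<^sup>+\<sigma>. emeasure (bernoulli_measure \<Omega> P) (cylinder \<Omega> {\<sigma>}) \<partial>count_space S)"
proof -
  have "disjoint_family_on (\<lambda>\<sigma>. cylinder \<Omega> {\<sigma>}) S"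
    unfolding disjoint_family_on_def cylinder_def
    using prefix_free_stake_unique[OF pf] by blast
  then show ?thesis
    unfolding cylinder_Union[of \<Omega> S] using S
    by (intro emeasure_UN_countable) (auto intro!: cylinder_in_sets)
qed


section \<open>Pulling back sets of binary strings\<close>

definition filter_bits :: "nat set \<Rightarrow> nat set \<Rightarrow> nat list \<Rightarrow> nat list" where
  "filter_bits A B \<sigma> = map (\<lambda>a. of_bool (a \<in> A)) (filter (\<lambda>a. a \<in> B) \<sigma>)"

text \<open>
  The strings over \<open>\<Omega>\<close> at whose end the bit string is found to be in \<open>S\<close>. Without the condition on the last
  letter, such a string could be extended by letters outside \<open>B\<close>, which do not change the bits, and
  prefix-freeness would be lost. The empty string is included so that the preimage of the empty bit string
  covers all sequences.
\<close>

definition pullback :: "nat set \<Rightarrow> nat set \<Rightarrow> nat set \<Rightarrow> nat list set \<Rightarrow> nat list set" where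
  "pullback \<Omega> A B S = {\<sigma> \<in> lists \<Omega>. (\<sigma> = [] \<or> last \<sigma> \<in> B) \<and> filter_bits A B \<sigma> \<in> S}"

text \<open>
  The probability of the bit \<open>x\<close> for the indicator of \<open>A\<close> under the conditional probability given \<open>B\<close>.
\<close>

definition bit_prob :: "nat set \<Rightarrow> (nat \<Rightarrow> real) \<Rightarrow> nat set \<Rightarrow> nat set \<Rightarrow> nat \<Rightarrow> real" where
  "bit_prob \<Omega> P A B x = event_prob P {a \<in> \<Omega> \<inter> B. of_bool (a \<in> A) = x} / event_prob P (\<Omega> \<inter> B)"

lemma bit_prob_1: "bit_prob \<Omega> P A B 1 = event_prob P (\<Omega> \<inter> B \<inter> A) / event_prob P (\<Omega> \<inter> B)"
proof -
  have "{a \<in> \<Omega> \<inter> B. of_bool (a \<in> A) = (1 :: nat)} = \<Omega> \<inter> B \<inter> A" by auto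
  then show ?thesis by (simp only: bit_prob_def)
qed

lemma bit_prob_in_prob_spaces:
  assumes P: "P \<in> prob_spaces \<Omega>" and B: "event_prob P (\<Omega> \<inter> B) > 0"
  shows "bit_prob \<Omega> P A B \<in> prob_spaces {0, 1}"
proof -
  let ?X = "\<lambda>x. {a \<in> \<Omega> \<inter> B. of_bool (a \<in> A) = (x :: nat)}"
  have "event_prob P (?X 0 \<union> ?X 1) = event_prob P (?X 0) + event_prob P (?X 1)"
    by (rule event_prob_Un_disjoint[OF P]) auto
  moreover have "?X 0 \<union> ?X 1 = \<Omega> \<inter> B" by auto
  ultimately have "event_prob P (?X 0) + event_prob P (?X 1) = event_prob P (\<Omega> \<inter> B)" by simp
  moreover have "event_prob P (?X x) \<ge> 0" for x by (rule event_prob_nonneg[OF P]) auto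
  ultimately show ?thesis
    using B unfolding prob_spaces_binary bit_prob_def
    by (simp del: of_bool_eq_0_iff of_bool_eq_1_iff mem_Collect_eq add: add_divide_distrib[symmetric])
qed

lemma pullback_subset: "pullback \<Omega> A B S \<subseteq> lists \<Omega>"
  unfolding pullback_def by blast

lemma prefix_free_pullback:
  assumes "prefix_free S"
  shows "prefix_free (pullback \<Omega> A B S)"
  unfolding prefix_free_def
proof (intro ballI impI)
  fix \<sigma> \<tau> assume \<sigma>: "\<sigma> \<in> pullback \<Omega> A B S" and \<tau>: "\<tau> \<in> pullback \<Omega> A B S" and "prefix \<sigma> \<tau>"
  then obtain \<rho> where \<rho>: "\<tau> = \<sigma> @ \<rho>" by (auto elim: prefixE)
  then have "filter_bits A B \<tau> = filter_bits A B \<sigma> @ filter_bits A B \<rho>"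
    by (simp add: filter_bits_def)
  then have "filter_bits A B \<rho> = []"
    using assms \<sigma> \<tau> unfolding prefix_free_def pullback_def
    by (metis (mono_tags, lifting) mem_Collect_eq prefixI append_self_conv)
  then have "\<forall>a\<in>set \<rho>. a \<notin> B" by (simp add: filter_bits_def filter_empty_conv)
  then have "\<rho> = []" using \<tau> \<rho> unfolding pullback_def by (cases \<rho> rule: rev_cases) auto
  with \<rho> show "\<sigma> = \<tau>" by simp
qed

text \<open>
  The effect of the first letter: a letter outside \<open>B\<close> leaves the task unchanged, and a letter in \<open>B\<close>
  settles the first bit.
\<close>

lemma SCons_in_cylinder_pullback_iff:
  assumes "t \<in> \<Omega>" "s \<in> streams \<Omega>"
  shows "t ## s \<in> cylinder \<Omega> (pullback \<Omega> A B {x # w}) \<longleftrightarrow>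
    (if t \<in> B then of_bool (t \<in> A) = x \<and> s \<in> cylinder \<Omega> (pullback \<Omega> A B {w})
     else s \<in> cylinder \<Omega> (pullback \<Omega> A B {x # w}))"
proof -
  have "t ## s \<in> cylinder \<Omega> (pullback \<Omega> A B {x # w}) \<longleftrightarrow>
      (\<exists>n. stake n (t ## s) \<in> pullback \<Omega> A B {x # w})"
    using assms by (simp add: cylinder_def)
  also have "\<dots> \<longleftrightarrow> (\<exists>n. t # stake n s \<in> pullback \<Omega> A B {x # w})"
  proof -
    have "[] \<notin> pullback \<Omega> A B {x # w}" by (simp add: pullback_def filter_bits_def)
    then show ?thesis by (metis not0_implies_Suc stake.simps stream.sel)
  qed
  finally have eq: "t ## s \<in> cylinder \<Omega> (pullback \<Omega> A B {x # w}) \<longleftrightarrow>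
      (\<exists>n. t # stake n s \<in> pullback \<Omega> A B {x # w})" .
  have "t # \<sigma> \<in> pullback \<Omega> A B {x # w} \<longleftrightarrow>
     (if t \<in> B then of_bool (t \<in> A) = x \<and> \<sigma> \<in> pullback \<Omega> A B {w}
      else \<sigma> \<in> pullback \<Omega> A B {x # w})" for \<sigma>
    using assms(1) by (cases "\<sigma> = []") (auto simp: pullback_def filter_bits_def)
  then have "(\<exists>n. t # stake n s \<in> pullback \<Omega> A B {x # w}) \<longleftrightarrow>
    (if t \<in> B then of_bool (t \<in> A) = x \<and> (\<exists>n. stake n s \<in> pullback \<Omega> A B {w})
      else (\<exists>n. stake n s \<in> pullback \<Omega> A B {x # w}))"
    by simp
  with eq show ?thesis
    using assms by (simp add: cylinder_def)
qed

text \<open>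
  Let \<open>e(w)\<close> denote the left-hand side. Conditioning on the first letter gives
  \<open>e(x w) = (1 - P(B)) e(x w) + P(B, bit x) e(w)\<close>, which determines \<open>e(x w)\<close> since \<open>P(B) > 0\<close>.
\<close>

lemma measure_cylinder_pullback_singleton:
  assumes P: "P \<in> prob_spaces \<Omega>" and B: "event_prob P (\<Omega> \<inter> B) > 0"
  shows "measure (bernoulli_measure \<Omega> P) (cylinder \<Omega> (pullback \<Omega> A B {w})) =
    (\<Prod>x\<leftarrow>w. bit_prob \<Omega> P A B x)"
proof (induction w)
  case Nil
  interpret prob_space "bernoulli_measure \<Omega> P"
    by (rule prob_space_bernoulli_measure[OF P])
  have "cylinder \<Omega> (pullback \<Omega> A B {[]}) = space (bernoulli_measure \<Omega> P)"
    unfolding space_bernoulli_measure cylinder_def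
    by (auto simp: pullback_def filter_bits_def intro!: exI[of _ 0])
  then show ?case using prob_space by simp
next
  case (Cons x w)
  let ?M = "point_measure \<Omega> (\<lambda>a. ennreal (P a))"
  let ?E = "\<lambda>w. cylinder \<Omega> (pullback \<Omega> A B {w})"
  let ?X = "{a \<in> \<Omega> \<inter> B. of_bool (a \<in> A) = x}"
  interpret M: prob_space ?M by (rule prob_space_point_measure[OF P])
  interpret S: prob_space "bernoulli_measure \<Omega> P" by (rule prob_space_bernoulli_measure[OF P])
  have sets: "?E v \<in> S.events" for v by (rule cylinder_in_sets[OF pullback_subset])
  have sets': "?E v \<in> sets (stream_space ?M)" for v
    using sets unfolding bernoulli_measure_def .
  have slice: "{s \<in> space (stream_space ?M). t ## s \<in> ?E (x # w)} =
      (if t \<in> B then if of_bool (t \<in> A) = x then ?E w else {} else ?E (x # w))" if "t \<in> \<Omega>" for t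
  proof -
    have "s \<in> streams \<Omega>" if "s \<in> ?E v" for s v using that by (simp add: cylinder_def)
    then show ?thesis
      using SCons_in_cylinder_pullback_iff[OF that, of _ A B x w]
      using that by (auto simp: space_stream_space space_point_measure streams_Stream)
  qed
  have "emeasure (bernoulli_measure \<Omega> P) (?E (x # w)) =
      (\<integral>\<^sup>+t. emeasure (bernoulli_measure \<Omega> P) (?E (x # w)) * indicator (\<Omega> - B) t
         + emeasure (bernoulli_measure \<Omega> P) (?E w) * indicator ?X t \<partial>?M)"
    unfolding bernoulli_measure_def
    by (subst M.emeasure_stream_space[OF sets'])
      (auto intro!: nn_integral_cong simp: slice space_point_measure split: split_indicator)
  also have "\<dots> = emeasure (bernoulli_measure \<Omega> P) (?E (x # w)) * emeasure ?M (\<Omega> - B)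
         + emeasure (bernoulli_measure \<Omega> P) (?E w) * emeasure ?M ?X"
    by (subst nn_integral_add) (auto simp: sets_point_measure nn_integral_cmult_indicator)
  finally have "ennreal (S.prob (?E (x # w))) =
      ennreal (S.prob (?E (x # w)) * M.prob (\<Omega> - B) + S.prob (?E w) * M.prob ?X)"
    by (simp add: S.emeasure_eq_measure M.emeasure_eq_measure ennreal_mult ennreal_plus)
  then have "S.prob (?E (x # w)) =
      S.prob (?E (x # w)) * M.prob (\<Omega> - B) + S.prob (?E w) * M.prob ?X"
    by (subst (asm) ennreal_inj) (simp_all add: add_nonneg_nonneg)
  also have "M.prob (\<Omega> - B) = 1 - event_prob P (\<Omega> \<inter> B)"
    using event_prob_Un_disjoint[OF P, of "\<Omega> - B" "\<Omega> \<inter> B"] event_prob_space[OF P]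
    by (simp add: measure_point_measure[OF P] Un_Diff_Int Diff_Int_distrib2)
  also have "M.prob ?X = event_prob P ?X"
    by (rule measure_point_measure[OF P]) auto
  finally have "S.prob (?E (x # w)) = bit_prob \<Omega> P A B x * S.prob (?E w)"
    using B by (simp add: bit_prob_def field_simps)
  then show ?case using Cons.IH by simp
qed

lemma measure_cylinder_pullback:
  assumes P: "P \<in> prob_spaces \<Omega>" and B: "event_prob P (\<Omega> \<inter> B) > 0"
    and S: "S \<subseteq> lists {0, 1}" and pf: "prefix_free S"
  shows "measure (bernoulli_measure \<Omega> P) (cylinder \<Omega> (pullback \<Omega> A B S)) =
    measure (bernoulli_measure {0, 1} (bit_prob \<Omega> P A B)) (cylinder {0, 1} S)"
proof -
  let ?Q = "bit_prob \<Omega> P A B"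
  let ?M = "bernoulli_measure \<Omega> P" and ?N = "bernoulli_measure {0, 1} ?Q"
  have Q: "?Q \<in> prob_spaces {0, 1}" by (rule bit_prob_in_prob_spaces[OF P B])
  interpret M: prob_space ?M by (rule prob_space_bernoulli_measure[OF P])
  interpret N: prob_space ?N by (rule prob_space_bernoulli_measure[OF Q])
  have "disjoint_family_on (\<lambda>w. cylinder \<Omega> (pullback \<Omega> A B {w})) S"
  proof -
    have "v = w" if "v \<in> S" "w \<in> S" "stake m \<alpha> \<in> pullback \<Omega> A B {v}"
      "stake n \<alpha> \<in> pullback \<Omega> A B {w}" for v w m n \<alpha>
    proof -
      have "stake m \<alpha> \<in> pullback \<Omega> A B S" "stake n \<alpha> \<in> pullback \<Omega> A B S"
        using that unfolding pullback_def by auto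
      then have "stake m \<alpha> = stake n \<alpha>"
        by (rule prefix_free_stake_unique[OF prefix_free_pullback[OF pf]])
      then show ?thesis using that unfolding pullback_def by auto
    qed
    then show ?thesis unfolding disjoint_family_on_def cylinder_def by blast
  qed
  moreover have "cylinder \<Omega> (pullback \<Omega> A B S) = (\<Union>w\<in>S. cylinder \<Omega> (pullback \<Omega> A B {w}))"
    by (auto simp: cylinder_def pullback_def)
  ultimately have "emeasure ?M (cylinder \<Omega> (pullback \<Omega> A B S)) =
      (\<integral>\<^sup>+w. emeasure ?M (cylinder \<Omega> (pullback \<Omega> A B {w})) \<partial>count_space S)"
    by (simp only:) (intro emeasure_UN_countable cylinder_in_sets pullback_subset, auto)
  also have "\<dots> = (\<integral>\<^sup>+w. emeasure ?N (cylinder {0, 1} {w}) \<partial>count_space S)"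
  proof (intro nn_integral_cong)
    fix w assume "w \<in> space (count_space S)"
    then have "w \<in> lists {0, 1}" using S by auto
    then show "emeasure ?M (cylinder \<Omega> (pullback \<Omega> A B {w})) = emeasure ?N (cylinder {0, 1} {w})"
      by (simp only: emeasure_bernoulli_measure_cylinder[OF Q] M.emeasure_eq_measure
          measure_cylinder_pullback_singleton[OF P B])
  qed
  also have "\<dots> = emeasure ?N (cylinder {0, 1} S)"
    by (rule emeasure_cylinder_prefix_free[OF S pf, symmetric])
  finally show ?thesis
    by (simp only: measure_def)
qed


section \<open>Bits of an ensemble form an ensemble\<close>

text \<open>
  A candidate is given by an index \<open>i\<close> in the enumeration of \<open>C\<close> and a list of indices in the enumeration of
  \<open>\<Omega>\<close>. The latter spells a word over \<open>\<Omega>\<close>, and it can be checked whether the word ends correctly and has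
  the bits that are required by the \<open>i\<close>-th element of \<open>C\<close>.
\<close>

lemma re_string_relation_pullback:
  assumes \<Omega>: "re_set \<Omega>" "\<Omega> \<noteq> {}" and A: "recursive_set A" and B: "recursive_set B"
    and C: "re_string_relation C"
  shows "re_string_relation {(n, \<sigma>). \<sigma> \<in> pullback \<Omega> A B (C `` {n})}"
proof (cases "C = {}")
  case True
  then show ?thesis by (simp add: re_string_relation_def re_set_def pullback_def)
next
  case False
  obtain g where g: "recursive_fun g" "\<Omega> = range g"
    using \<Omega> unfolding re_set_def by blast
  obtain f where f: "recursive_fun f" "encode_pair ` C = range f"
    using C False unfolding re_string_relation_def re_set_def by auto
  define word where "word x = list_encode (map g (list_decode (psnd x)))" for x
  define p where "p x \<longleftrightarrow> (list_decode (word x) = [] \<or> last (list_decode (word x)) \<in> B) \<and>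
    list_encode (filter_bits A B (list_decode (word x))) = psnd (f (pfst x))" for x
  define e where "e x = pair (pfst (f (pfst x))) (word x)" for x
  have word: "recursive_fun word"
    unfolding word_def by (intro recursive_fun_map recursive_intros g)
  have fx: "recursive_fun (\<lambda>x. f (pfst x))"
    by (rule recursive_fun_comp[OF f(1) recursive_fun_pfst])
  have "recursive_fun e"
    unfolding e_def by (intro recursive_intros word fx)
  moreover have "recursive_pred p"
    unfolding p_def filter_bits_def
    by (intro recursive_pred_conj recursive_pred_last recursive_pred_eq recursive_fun_map_filter
        recursive_fun_comp[OF recursive_fun_psnd] recursive_fun_of_bool recursive_pred_mem
        recursive_fun_id A B word fx)
  ultimately have "re_set (e ` {x. p x})" by (rule re_set_image_Collect)
  moreover have "encode_pair ` {(n, \<sigma>). \<sigma> \<in> pullback \<Omega> A B (C `` {n})} = e ` {x. p x}" (is "?L = ?R")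
  proof (intro equalityI subsetI)
    fix z assume "z \<in> ?L"
    then obtain n \<sigma> where z: "z = pair n (list_encode \<sigma>)" and \<sigma>: "\<sigma> \<in> lists \<Omega>"
      "\<sigma> = [] \<or> last \<sigma> \<in> B" "(n, filter_bits A B \<sigma>) \<in> C"
      unfolding pullback_def by auto
    then have "encode_pair (n, filter_bits A B \<sigma>) \<in> range f"
      using f(2) by blast
    then obtain i where i: "f i = pair n (list_encode (filter_bits A B \<sigma>))" by auto
    have "\<sigma> \<in> range (map g)"
      using \<sigma>(1) g(2) by (metis lists_image lists_UNIV)
    then obtain s where s: "\<sigma> = map g s" by blast
    have "p (pair i (list_encode s))" "z = e (pair i (list_encode s))"
      using \<sigma>(2) by (simp_all add: p_def e_def word_def i s[symmetric] z)
    then show "z \<in> ?R" by blast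
  next
    fix z assume "z \<in> ?R"
    then obtain x where x: "p x" "z = e x" by blast
    have "f (pfst x) \<in> encode_pair ` C" using f(2) by blast
    then obtain n w where nw: "(n, w) \<in> C" "f (pfst x) = pair n (list_encode w)" by auto
    let ?\<sigma> = "map g (list_decode (psnd x))"
    have "filter_bits A B ?\<sigma> = w"
      using x(1) nw(2) by (simp add: p_def word_def list_encode_eq)
    then have "?\<sigma> \<in> pullback \<Omega> A B (C `` {n})"
      using x(1) nw(1) g(2) unfolding pullback_def p_def word_def by auto
    moreover have "z = encode_pair (n, ?\<sigma>)"
      using x(2) nw(2) by (simp add: e_def word_def)
    ultimately show "z \<in> ?L" by blast
  qed
  ultimately show ?thesis unfolding re_string_relation_def by simp
qed

lemma sfilter_shift: "\<forall>x\<in>set xs. \<not> P x \<Longrightarrow> sfilter P (xs @- s) = sfilter P s"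
  by (induction xs) (simp_all add: sfilter_Stream)

text \<open>
  Each prefix of the filtered sequence is reached at a prefix of the original sequence that ends in a
  selected letter. This is what makes a pulled-back test catch the original sequence.
\<close>

lemma stake_sfilter:
  assumes "\<forall>n. \<exists>i\<ge>n. P (s !! i)"
  shows "\<exists>m. filter P (stake m s) = stake k (sfilter P s) \<and> (stake m s = [] \<or> P (last (stake m s)))"
  using assms
proof (induction k arbitrary: s)
  case 0
  show ?case by (intro exI[of _ 0]) simp
next
  case (Suc k)
  define j where "j = (LEAST j. P (s !! j))"
  have "\<exists>j. P (s !! j)" using Suc.prems by blast
  then have Pj: "P (s !! j)" unfolding j_def by (rule LeastI_ex)
  have before: "\<forall>x\<in>set (stake j s). \<not> P x"
    unfolding j_def using not_less_Least[of _ "\<lambda>j. P (s !! j)"] by (auto simp: in_set_conv_nth)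
  define t where "t = sdrop (Suc j) s"
  have s: "s = stake j s @- (s !! j ## t)"
    unfolding t_def by (metis id_stake_snth_sdrop)
  have "\<forall>n. \<exists>i\<ge>n. P (t !! i)"
  proof
    fix n
    obtain i where "i \<ge> n + Suc j" "P (s !! i)" using Suc.prems by blast
    then show "\<exists>i\<ge>n. P (t !! i)"
      by (intro exI[of _ "i - Suc j"]) (simp add: t_def sdrop_snth del: sdrop.simps)
  qed
  from Suc.IH[OF this] obtain m where m: "filter P (stake m t) = stake k (sfilter P t)"
    "stake m t = [] \<or> P (last (stake m t))" by blast
  have "stake (j + Suc m) s = stake j s @ s !! j # stake m t"
    by (simp only: stake_add[symmetric] stake.simps t_def) (simp add: sdrop_simps)
  moreover have "sfilter P s = s !! j ## sfilter P t"
    using Pj by (subst s) (simp add: sfilter_shift[OF before] sfilter_Stream)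
  moreover have "filter P (stake j s) = []"
    using before by (simp add: filter_empty_conv)
  ultimately show ?case
    using m Pj by (intro exI[of _ "j + Suc m"]) auto
qed

text \<open>
  A test that catches the bits of \<open>\<alpha>\<close> at every level would pull back to a test of the same measure that
  catches \<open>\<alpha>\<close> at every level.
\<close>

theorem ensemble_char_seq_filtered:
  assumes \<Omega>: "re_set \<Omega>" and P: "P \<in> prob_spaces \<Omega>"
    and A: "recursive_set A" and B: "recursive_set B" and pos: "event_prob P (\<Omega> \<inter> B) > 0"
    and \<alpha>: "ensemble \<Omega> P \<alpha>" and inf: "\<forall>n. \<exists>i\<ge>n. \<alpha> !! i \<in> B"
  shows "ensemble {0, 1} (bit_prob \<Omega> P A B) (char_seq A (filtered B \<alpha>))"
  unfolding ensemble_def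
proof (intro conjI allI impI)
  let ?\<gamma> = "char_seq A (filtered B \<alpha>)"
  show "?\<gamma> \<in> streams {0, 1}"
    by (simp add: char_seq_def streams_iff_snth)
  fix C assume C: "martin_loef_test {0, 1} (bit_prob \<Omega> P A B) C"
  let ?D = "{(n, \<sigma>). \<sigma> \<in> pullback \<Omega> A B (C `` {n})}"
  have "\<Omega> \<noteq> {}" using event_prob_space[OF P] by (auto simp: event_prob_def)
  have \<alpha>_in: "\<alpha> \<in> streams \<Omega>" using \<alpha> by (simp add: ensemble_def)
  have D: "?D `` {n} = pullback \<Omega> A B (C `` {n})" for n by auto
  have "martin_loef_test \<Omega> P ?D"
    unfolding martin_loef_test_def
  proof (intro conjI allI impI)
    show "?D \<subseteq> {1..} \<times> lists \<Omega>"
      using C unfolding martin_loef_test_def pullback_def by auto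
    show "re_string_relation ?D"
      using C \<Omega> \<open>\<Omega> \<noteq> {}\<close> A B
      by (intro re_string_relation_pullback) (simp_all add: martin_loef_test_def)
    fix n :: nat assume n: "1 \<le> n"
    then have pf: "prefix_free (C `` {n})"
      and small: "measure (bernoulli_measure {0, 1} (bit_prob \<Omega> P A B)) (cylinder {0, 1} (C `` {n})) < (1 / 2) ^ n"
      using C unfolding martin_loef_test_def by blast+
    show "prefix_free (?D `` {n})" unfolding D by (rule prefix_free_pullback[OF pf])
    show "measure (bernoulli_measure \<Omega> P) (cylinder \<Omega> (?D `` {n})) < (1 / 2) ^ n"
      unfolding D measure_cylinder_pullback[OF P pos test_section_subset[OF C] pf] by (rule small)
  qed
  then obtain n where "n \<ge> 1" "\<alpha> \<notin> cylinder \<Omega> (?D `` {n})"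
    using \<alpha> unfolding ensemble_def by blast
  then have n: "n \<ge> 1" "\<alpha> \<notin> cylinder \<Omega> (pullback \<Omega> A B (C `` {n}))"
    unfolding D .
  have "stake k ?\<gamma> \<notin> C `` {n}" for k
  proof
    assume k: "stake k ?\<gamma> \<in> C `` {n}"
    obtain m where m: "filter (\<lambda>a. a \<in> B) (stake m \<alpha>) = stake k (filtered B \<alpha>)"
      "stake m \<alpha> = [] \<or> last (stake m \<alpha>) \<in> B"
      using stake_sfilter[of "\<lambda>a. a \<in> B", OF inf] unfolding filtered_def by blast
    have "filter_bits A B (stake m \<alpha>) = stake k ?\<gamma>"
      by (simp add: filter_bits_def m(1) char_seq_def)
    moreover have "set (stake m \<alpha>) \<subseteq> \<Omega>"
      using \<alpha>_in by (auto simp: in_set_conv_nth streams_iff_snth)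
    ultimately have "stake m \<alpha> \<in> pullback \<Omega> A B (C `` {n})"
      using m(2) k by (auto simp: pullback_def)
    then show False using n(2) \<alpha>_in by (auto simp: cylinder_def)
  qed
  then show "\<exists>n\<ge>1. ?\<gamma> \<notin> cylinder {0, 1} (C `` {n})"
    using n(1) by (auto simp: cylinder_def)
qed

corollary ensemble_char_seq:
  assumes "re_set \<Omega>" and P: "P \<in> prob_spaces \<Omega>" and "recursive_set A" and "ensemble \<Omega> P \<alpha>"
  shows "ensemble {0, 1} (bit_prob \<Omega> P A UNIV) (char_seq A \<alpha>)"
proof -
  have step: "sfilter (\<lambda>a. True) s = shd s ## sfilter (\<lambda>a. True) (stl s)" for s :: "nat stream"
    using sfilter_Stream[of "\<lambda>a. True" "shd s" "stl s"] unfolding stream.collapse if_True .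
  have "sfilter (\<lambda>a. True) s = s" for s :: "nat stream"
  proof (coinduction arbitrary: s)
    case Eq_stream
    have "shd (sfilter (\<lambda>a. True) s) = shd s"
      "stl (sfilter (\<lambda>a. True) s) = sfilter (\<lambda>a. True) (stl s)"
      by (subst step, simp only: stream.sel)+
    then show ?case by blast
  qed
  then have "filtered UNIV \<alpha> = \<alpha>" by (simp only: filtered_def UNIV_I)
  moreover have "recursive_set UNIV" by (simp add: recursive_set_def recursive_fun_const)
  ultimately show ?thesis
    using ensemble_char_seq_filtered[OF assms(1-3), of UNIV \<alpha>] assms(4) event_prob_space[OF P]
    by (metis Int_UNIV_right UNIV_I order_refl zero_less_one)
qed


section \<open>Exponential tilting\<close>

text \<open>
  Both sides are equal at \<open>z = 1\<close>, and the derivatives there are \<open>b q\<close> on the left and the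
  larger number \<open>a\<close> on the right.
\<close>

lemma exists_tilting_base:
  assumes "real b * q < real a"
  shows "\<exists>z>1. q * z ^ b + (1 - q) < (z :: real) ^ a"
proof -
  let ?f = "\<lambda>z::real. z ^ a - q * z ^ b"
  have "(?f has_real_derivative real a - q * real b) (at 1)"
    by (auto intro!: derivative_eq_intros)
  then obtain d where d: "d > 0" "\<And>h. 0 < h \<Longrightarrow> h < d \<Longrightarrow> ?f 1 < ?f (1 + h)"
    using DERIV_pos_inc_right[of ?f "real a - q * real b" 1] assms by (auto simp: mult.commute)
  show ?thesis
    using d(2)[of "d / 2"] d(1) by (intro exI[of _ "1 + d / 2"]) simp
qed

text \<open>
  Give each letter \<open>x\<close> the weight \<open>z\<^bsup>b x\<^esup>\<close>. Dividing the weighted probabilities by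
  \<open>s = Q(1) z\<^bsup>b\<^esup> + Q(0)\<close> gives a new probability space \<open>R\<close> on the bits. By the lower bound on the
  number of ones, a string in \<open>S\<close> of length \<open>l\<close> has weight at least \<open>z\<^bsup>a l\<^esup>\<close>. So its
  \<open>Q\<close>-probability is at most \<open>(s / z\<^bsup>a\<^esup>)\<^bsup>l\<^esup>\<close> times its \<open>R\<close>-probability, and the \<open>R\<close>-probabilities of
  a prefix-free set sum to at most 1.
\<close>

lemma measure_long_excess_strings:
  assumes Q: "Q \<in> prob_spaces {0, 1}" and z: "z > 1"
    and S: "S \<subseteq> lists {0, 1}" and pf: "prefix_free S"
    and len: "\<And>\<sigma>. \<sigma> \<in> S \<Longrightarrow> L \<le> length \<sigma>"
    and excess: "\<And>\<sigma>. \<sigma> \<in> S \<Longrightarrow> a * length \<sigma> \<le> b * sum_list \<sigma>"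
    and small: "Q 1 * z ^ b + Q 0 \<le> z ^ a"
  shows "measure (bernoulli_measure {0, 1} Q) (cylinder {0, 1} S) \<le> ((Q 1 * z ^ b + Q 0) / z ^ a) ^ L"
proof -
  define s where "s = Q 1 * z ^ b + Q 0"
  define \<rho> where "\<rho> = s / z ^ a"
  define R where "R x = Q x * z ^ (b * x) / s" for x
  have Q01: "0 \<le> Q 0" "0 \<le> Q 1" "Q 0 + Q 1 = 1"
    using Q by (simp_all only: prob_spaces_binary)
  have "Q 1 * 1 \<le> Q 1 * z ^ b"
    using z Q01 by (intro mult_left_mono one_le_power) auto
  then have s: "s \<ge> 1" using Q01 by (simp add: s_def)
  have \<rho>: "0 \<le> \<rho>" "\<rho> \<le> 1"
    using s z small by (simp_all add: \<rho>_def s_def)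
  have R: "R \<in> prob_spaces {0, 1}"
    using Q01 s z unfolding prob_spaces_binary R_def
    by (simp add: s_def add_divide_distrib[symmetric] add.commute)
  interpret N: prob_space "bernoulli_measure {0, 1} R" by (rule prob_space_bernoulli_measure[OF R])
  interpret M: prob_space "bernoulli_measure {0, 1} Q" by (rule prob_space_bernoulli_measure[OF Q])
  have nonneg: "0 \<le> (\<Prod>x\<leftarrow>\<sigma>. R x)" if "\<sigma> \<in> lists {0, 1}" for \<sigma>
    using that Q01 s z by (intro prod_list_nonneg) (auto simp: R_def)
  have tilt: "(\<Prod>x\<leftarrow>\<sigma>. Q x) * z ^ (b * sum_list \<sigma>) = s ^ length \<sigma> * (\<Prod>x\<leftarrow>\<sigma>. R x)" for \<sigma>
  proof (induction \<sigma>)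
    case (Cons x \<sigma>)
    have "(\<Prod>x\<leftarrow>x # \<sigma>. Q x) * z ^ (b * sum_list (x # \<sigma>)) =
        (Q x * z ^ (b * x)) * ((\<Prod>x\<leftarrow>\<sigma>. Q x) * z ^ (b * sum_list \<sigma>))"
      by (simp add: algebra_simps power_add)
    also have "Q x * z ^ (b * x) = s * R x"
      using s by (simp add: R_def)
    finally show ?case using Cons.IH by simp
  qed simp
  have le: "(\<Prod>x\<leftarrow>\<sigma>. Q x) \<le> \<rho> ^ L * (\<Prod>x\<leftarrow>\<sigma>. R x)" if "\<sigma> \<in> S" for \<sigma>
  proof -
    have \<sigma>: "\<sigma> \<in> lists {0, 1}" using S that by blast
    have Qn: "0 \<le> (\<Prod>x\<leftarrow>\<sigma>. Q x)"
      using \<sigma> Q01 by (intro prod_list_nonneg) auto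
    have "(\<Prod>x\<leftarrow>\<sigma>. Q x) * z ^ (a * length \<sigma>) \<le> (\<Prod>x\<leftarrow>\<sigma>. Q x) * z ^ (b * sum_list \<sigma>)"
      using z excess[OF that] Qn by (intro mult_left_mono power_increasing) auto
    also have "\<dots> = \<rho> ^ length \<sigma> * (\<Prod>x\<leftarrow>\<sigma>. R x) * z ^ (a * length \<sigma>)"
      using z by (simp add: tilt \<rho>_def power_divide power_mult[of z a])
    finally have "(\<Prod>x\<leftarrow>\<sigma>. Q x) \<le> \<rho> ^ length \<sigma> * (\<Prod>x\<leftarrow>\<sigma>. R x)"
      using z by simp
    also have "\<dots> \<le> \<rho> ^ L * (\<Prod>x\<leftarrow>\<sigma>. R x)"
      using \<rho> len[OF that] nonneg[OF \<sigma>] by (intro mult_right_mono power_decreasing) auto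
    finally show ?thesis .
  qed
  have "emeasure (bernoulli_measure {0, 1} Q) (cylinder {0, 1} S) =
      (\<integral>\<^sup>+\<sigma>. emeasure (bernoulli_measure {0, 1} Q) (cylinder {0, 1} {\<sigma>}) \<partial>count_space S)"
    by (rule emeasure_cylinder_prefix_free[OF S pf])
  also have "\<dots> \<le> (\<integral>\<^sup>+\<sigma>. ennreal (\<rho> ^ L) *
      emeasure (bernoulli_measure {0, 1} R) (cylinder {0, 1} {\<sigma>}) \<partial>count_space S)"
  proof (intro nn_integral_mono)
    fix \<sigma> assume "\<sigma> \<in> space (count_space S)"
    then have "\<sigma> \<in> S" "\<sigma> \<in> lists {0, 1}" using S by auto
    then show "emeasure (bernoulli_measure {0, 1} Q) (cylinder {0, 1} {\<sigma>}) \<le>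
        ennreal (\<rho> ^ L) * emeasure (bernoulli_measure {0, 1} R) (cylinder {0, 1} {\<sigma>})"
      using le \<rho>(1) by (simp only: emeasure_bernoulli_measure_cylinder[OF Q]
          emeasure_bernoulli_measure_cylinder[OF R] ennreal_mult'[symmetric] zero_le_power ennreal_leI)
  qed
  also have "\<dots> = ennreal (\<rho> ^ L) * emeasure (bernoulli_measure {0, 1} R) (cylinder {0, 1} S)"
    by (simp only: emeasure_cylinder_prefix_free[OF S pf, of R]) (rule nn_integral_cmult, simp)
  also have "\<dots> \<le> ennreal (\<rho> ^ L) * 1"
    by (intro mult_left_mono N.emeasure_le_1) simp
  finally have "ennreal (M.prob (cylinder {0, 1} S)) \<le> ennreal (\<rho> ^ L)"
    by (simp only: M.emeasure_eq_measure mult_1_right)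
  then show ?thesis
    using \<rho>(1) by (simp add: \<rho>_def s_def)
qed


section \<open>The frequency of ones in an ensemble\<close>

text \<open>
  On binary strings, \<^const>\<open>sum_list\<close> counts the ones, so for \<open>b > 0\<close> the second condition bounds their
  frequency from below by \<open>a / b\<close>.
\<close>

definition excess :: "nat \<Rightarrow> nat \<Rightarrow> nat \<Rightarrow> nat list \<Rightarrow> bool" where
  "excess a b L \<sigma> \<longleftrightarrow> L \<le> length \<sigma> \<and> a * length \<sigma> \<le> b * sum_list \<sigma>"

definition first_excess :: "nat \<Rightarrow> nat \<Rightarrow> nat \<Rightarrow> nat list set" where
  "first_excess a b L =
    {\<sigma> \<in> lists {0, 1}. (\<forall>k<length \<sigma>. \<not> excess a b L (take k \<sigma>)) \<and> excess a b L \<sigma>}"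

lemma prefix_free_first_excess: "prefix_free (first_excess a b L)"
  unfolding prefix_free_def
proof (intro ballI impI)
  fix \<sigma> \<tau> assume \<sigma>: "\<sigma> \<in> first_excess a b L" and \<tau>: "\<tau> \<in> first_excess a b L" and "prefix \<sigma> \<tau>"
  then have take: "\<sigma> = take (length \<sigma>) \<tau>" by (auto elim: prefixE)
  then have "\<not> length \<sigma> < length \<tau>"
    using \<sigma> \<tau> unfolding first_excess_def by auto
  with take show "\<sigma> = \<tau>" by simp
qed

text \<open>
  The string is scanned once. The accumulator holds \<open>L\<close>, the length and the number of ones read so far, and a
  flag. The flag stays 1 as long as all letters are bits and no proper prefix of the part already read is
  in excess, so the decision for the whole string is made after the scan.
\<close>

lemma recursive_pred_first_excess:
  assumes L: "recursive_fun L" and l: "recursive_fun l"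
  shows "recursive_pred (\<lambda>x. list_decode (l x) \<in> first_excess a b (L x))"
proof -
  define len where "len st = pfst (psnd st)" for st
  define ones where "ones st = pfst (psnd (psnd st))" for st
  define ok where "ok st = psnd (psnd (psnd st))" for st
  define exc where "exc st \<longleftrightarrow> pfst st \<le> len st \<and> a * len st \<le> b * ones st" for st
  define step where "step x st = pair (pfst st) (pair (Suc (len st)) (pair (ones st + x)
    (of_bool (ok st = 1 \<and> \<not> exc st \<and> x \<le> 1))))" for x st
  define good where
    "good L \<sigma> \<longleftrightarrow> \<sigma> \<in> lists {0, 1} \<and> (\<forall>k<length \<sigma>. \<not> excess a b L (take k \<sigma>))" for L \<sigma>
  have step_eq: "step x (pair L (pair n (pair s (of_bool g)))) = pair L (pair (Suc n) (pair (s + x)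
      (of_bool (g \<and> \<not> (L \<le> n \<and> a * n \<le> b * s) \<and> x \<le> 1))))" for x L n s g
    by (simp add: step_def len_def ones_def ok_def exc_def)
  have fold: "fold step \<sigma> (pair L (pair 0 (pair 0 1))) =
      pair L (pair (length \<sigma>) (pair (sum_list \<sigma>) (of_bool (good L \<sigma>))))" for L \<sigma>
  proof (induction \<sigma> rule: rev_induct)
    case (snoc x \<sigma>)
    have "good L (\<sigma> @ [x]) \<longleftrightarrow> good L \<sigma> \<and> \<not> excess a b L \<sigma> \<and> x \<le> 1"
      by (auto simp: good_def less_Suc_eq)
    moreover have "fold step (\<sigma> @ [x]) (pair L (pair 0 (pair 0 1))) =
        step x (fold step \<sigma> (pair L (pair 0 (pair 0 1))))"
      by simp
    ultimately show ?case
      unfolding snoc.IH step_eq by (simp add: excess_def)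
  qed (simp add: good_def)
  have acc: "recursive_fun (\<lambda>z. len (psnd z))" "recursive_fun (\<lambda>z. ones (psnd z))"
      "recursive_fun (\<lambda>z. ok (psnd z))" "recursive_fun len" "recursive_fun ones" "recursive_fun ok"
    unfolding len_def ones_def ok_def by (intro recursive_intros)+
  have step: "recursive_fun (\<lambda>z. step (pfst z) (psnd z))"
    unfolding step_def exc_def by (intro recursive_intros acc)
  let ?res = "\<lambda>x. fold step (list_decode (l x)) (pair (L x) (pair 0 (pair 0 1)))"
  have res: "recursive_fun ?res"
    by (intro recursive_fun_fold recursive_intros step L l)
  have "list_decode (l x) \<in> first_excess a b (L x) \<longleftrightarrow> ok (?res x) = 1 \<and> exc (?res x)" for x
    by (simp only: fold) (auto simp: first_excess_def good_def ok_def exc_def len_def ones_def excess_def)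
  moreover have "recursive_pred (\<lambda>x. ok (?res x) = 1 \<and> exc (?res x))"
    unfolding exc_def
    by (intro recursive_pred_conj recursive_pred_eq recursive_pred_le recursive_fun_const
        recursive_fun_comp2[OF recursive_fun2_mult] recursive_fun_comp[OF recursive_fun_pfst res]
        recursive_fun_comp[OF acc(4) res] recursive_fun_comp[OF acc(5) res]
        recursive_fun_comp[OF acc(6) res])
  ultimately show ?thesis by simp
qed

text \<open>
  With \<open>\<rho>\<^bsup>c\<^esup> < 1 / 2\<close>, the first strings of length at least \<open>c n\<close> that are in excess form level \<open>n\<close> of a test.
  A sequence that escapes level \<open>n\<close> has no prefix in excess from length \<open>c n\<close> on.
\<close>

theorem eventually_few_ones:
  assumes Q: "Q \<in> prob_spaces {0, 1}" and ab: "real b * Q 1 < real a" and \<gamma>: "ensemble {0, 1} Q \<gamma>"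
  shows "\<exists>N. \<forall>l\<ge>N. b * sum_list (stake l \<gamma>) < a * l"
proof -
  have Q01: "0 \<le> Q 0" "0 \<le> Q 1" "Q 0 + Q 1 = 1"
    using Q by (simp_all only: prob_spaces_binary)
  obtain z where z: "z > 1" "Q 1 * z ^ b + (1 - Q 1) < z ^ a"
    using exists_tilting_base[OF ab] by blast
  then have z0: "Q 1 * z ^ b + Q 0 < z ^ a" using Q01 by simp
  define \<rho> where "\<rho> = (Q 1 * z ^ b + Q 0) / z ^ a"
  have \<rho>: "0 \<le> \<rho>" "\<rho> < 1"
    using z0 z(1) Q01 by (simp_all add: \<rho>_def)
  obtain c where c: "\<rho> ^ c < 1 / 2"
    using real_arch_pow_inv[of "1 / 2" \<rho>] \<rho> by auto
  define C where "C = {(n, \<sigma>). 1 \<le> n \<and> \<sigma> \<in> first_excess a b (c * n)}"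
  have Cn: "C `` {n} = first_excess a b (c * n)" if "n \<ge> 1" for n
    using that by (auto simp: C_def)
  have "martin_loef_test {0, 1} Q C"
    unfolding martin_loef_test_def
  proof (intro conjI allI impI)
    show "C \<subseteq> {1..} \<times> lists {0, 1}"
      by (auto simp: C_def first_excess_def)
    have "recursive_pred (\<lambda>x. 1 \<le> pfst x \<and> list_decode (psnd x) \<in> first_excess a b (c * pfst x))"
      by (intro recursive_pred_conj recursive_pred_first_excess recursive_intros)
    then have "re_set ((\<lambda>x. x) ` {x. 1 \<le> pfst x \<and> list_decode (psnd x) \<in> first_excess a b (c * pfst x)})"
      by (rule re_set_image_Collect[OF recursive_fun_id])
    moreover have "encode_pair ` C =
        {x. 1 \<le> pfst x \<and> list_decode (psnd x) \<in> first_excess a b (c * pfst x)}" (is "_ = ?R")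
    proof (intro equalityI subsetI)
      fix x assume x: "x \<in> ?R"
      have "x = encode_pair (pfst x, list_decode (psnd x))" by simp
      moreover have "(pfst x, list_decode (psnd x)) \<in> C" using x by (simp add: C_def)
      ultimately show "x \<in> encode_pair ` C" by (rule image_eqI)
    qed (auto simp: C_def)
    ultimately show "re_string_relation C" by (simp add: re_string_relation_def)
    fix n :: nat assume n: "1 \<le> n"
    show "prefix_free (C `` {n})" unfolding Cn[OF n] by (rule prefix_free_first_excess)
    have "measure (bernoulli_measure {0, 1} Q) (cylinder {0, 1} (C `` {n})) \<le> \<rho> ^ (c * n)"
      unfolding Cn[OF n] \<rho>_def using z0
      by (intro measure_long_excess_strings[OF Q z(1)] prefix_free_first_excess)
        (auto simp: first_excess_def excess_def)
    also have "\<dots> < (1 / 2) ^ n"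
      using c \<rho>(1) n unfolding power_mult by (intro power_strict_mono) auto
    finally show "measure (bernoulli_measure {0, 1} Q) (cylinder {0, 1} (C `` {n})) < (1 / 2) ^ n" .
  qed
  then obtain n where "n \<ge> 1" "\<gamma> \<notin> cylinder {0, 1} (C `` {n})"
    using \<gamma> unfolding ensemble_def by blast
  then have n: "\<gamma> \<notin> cylinder {0, 1} (first_excess a b (c * n))" by (simp add: Cn)
  have \<gamma>_in: "\<gamma> \<in> streams {0, 1}" using \<gamma> by (simp add: ensemble_def)
  have "\<not> excess a b (c * n) (stake l \<gamma>)" for l
  proof (induction l rule: less_induct)
    case (less l)
    have "stake l \<gamma> ! i \<in> {0, 1}" if "i < l" for i
      using \<gamma>_in that by (simp only: streams_iff_snth stake_nth)
    then have "stake l \<gamma> \<in> lists {0, 1}"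
      by (metis in_listsI in_set_conv_nth length_stake)
    moreover have "stake l \<gamma> \<notin> first_excess a b (c * n)"
      using n \<gamma>_in by (auto simp: cylinder_def)
    moreover have "\<not> excess a b (c * n) (take k (stake l \<gamma>))" if "k < length (stake l \<gamma>)" for k
      using that less by (simp add: take_stake min_def)
    ultimately show ?case unfolding first_excess_def by blast
  qed
  then show ?thesis
    unfolding excess_def length_stake by (meson not_le)
qed

text \<open>
  The law for ones carries over to recursive events in any alphabet because the indicator sequence of an
  ensemble is an ensemble.
\<close>

corollary eventually_few_occurrences:
  assumes "re_set \<Omega>" and P: "P \<in> prob_spaces \<Omega>" and "recursive_set A" and "ensemble \<Omega> P \<alpha>"
    and ab: "real b * event_prob P (\<Omega> \<inter> A) < real a"
  shows "\<exists>N. \<forall>l\<ge>N. b * length (filter (\<lambda>x. x \<in> A) (stake l \<alpha>)) < a * l"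
proof -
  have "\<exists>N. \<forall>l\<ge>N. b * sum_list (stake l (char_seq A \<alpha>)) < a * l"
  proof (rule eventually_few_ones)
    show "bit_prob \<Omega> P A UNIV \<in> prob_spaces {0, 1}"
      by (rule bit_prob_in_prob_spaces[OF P]) (simp add: event_prob_space[OF P])
    show "ensemble {0, 1} (bit_prob \<Omega> P A UNIV) (char_seq A \<alpha>)"
      using assms by (intro ensemble_char_seq)
    show "real b * bit_prob \<Omega> P A UNIV 1 < real a"
      unfolding bit_prob_1 using ab by (simp add: event_prob_space[OF P])
  qed
  moreover have "sum_list (stake l (char_seq A \<alpha>)) = length (filter (\<lambda>x. x \<in> A) (stake l \<alpha>))" for l
  proof -
    have "sum_list (map (\<lambda>x. of_bool (x \<in> A)) xs) = length (filter (\<lambda>x. x \<in> A) xs)" for xs :: "nat list"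
      by (induction xs) auto
    then show ?thesis by (simp add: char_seq_def)
  qed
  ultimately show ?thesis by simp
qed


section \<open>Uniqueness of the success probability\<close>

lemma nat_fraction_between:
  assumes "0 \<le> x" "x < y"
  shows "\<exists>a b::nat. b > 0 \<and> real b * x < real a \<and> real a < real b * y"
proof -
  obtain r where r: "r \<in> \<rat>" "x < r" "r < y" using Rats_dense_in_real[OF assms(2)] by blast
  then obtain a b :: nat where "b \<noteq> 0" "\<bar>r\<bar> = real a / real b" by (auto elim: Rats_abs_nat_div_natE)
  then have "b > 0" "r = real a / real b" using r assms by auto
  with r have "b > 0 \<and> real b * x < real a \<and> real a < real b * y"
    by (simp add: field_simps)
  then show ?thesis by blast
qed

text \<open>
  The complement of \<open>B\<close> has probability below 1, so its frequency is eventually below some \<open>a / b < 1\<close>. If \<open>B\<close>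
  did not occur from position \<open>n\<close> on, that frequency would tend to 1.
\<close>

theorem ensemble_infinitely_many:
  assumes "re_set \<Omega>" and P: "P \<in> prob_spaces \<Omega>" and "recursive_set B" and "ensemble \<Omega> P \<alpha>"
    and pos: "event_prob P (\<Omega> \<inter> B) > 0"
  shows "\<exists>i\<ge>n. \<alpha> !! i \<in> B"
proof (rule ccontr)
  assume none: "\<not> (\<exists>i\<ge>n. \<alpha> !! i \<in> B)"
  have "0 \<le> event_prob P (\<Omega> \<inter> - B)" by (rule event_prob_nonneg[OF P]) simp
  then obtain a b :: nat where ab: "real b * event_prob P (\<Omega> \<inter> - B) < real a" "real a < real b * 1"
    using nat_fraction_between[of "event_prob P (\<Omega> \<inter> - B)" 1] pos event_prob_Compl[OF P, of B] by auto
  obtain N where N: "\<And>l. l \<ge> N \<Longrightarrow> b * length (filter (\<lambda>x. x \<in> - B) (stake l \<alpha>)) < a * l"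
    using eventually_few_occurrences[OF assms(1) P recursive_set_Compl[OF assms(3)] assms(4) ab(1)] by blast
  \<comment> \<open>Large enough for the law to apply and for the first \<open>n\<close> letters to be outweighed: the count is at
     least \<open>l - n\<close>, and \<open>b (l - n) < (b - 1) l\<close> would force \<open>l < b n\<close>.\<close>
  define l where "l = n + (N + b * n)"
  have "stake l \<alpha> = stake n \<alpha> @ stake (l - n) (sdrop n \<alpha>)"
    by (simp only: stake_add) (simp add: l_def)
  moreover have "filter (\<lambda>x. x \<in> - B) (stake (l - n) (sdrop n \<alpha>)) = stake (l - n) (sdrop n \<alpha>)"
    using none by (auto simp: filter_id_conv in_set_conv_nth sdrop_snth)
  ultimately have "l - n \<le> length (filter (\<lambda>x. x \<in> - B) (stake l \<alpha>))"
    by (metis filter_append length_append length_stake le_add2)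
  then have "b * (l - n) \<le> b * length (filter (\<lambda>x. x \<in> - B) (stake l \<alpha>))" by simp
  also have "\<dots> < a * l" by (rule N) (simp add: l_def)
  also have "\<dots> \<le> (b - 1) * l" using ab(2) by (intro mult_right_mono) auto
  finally have "b * (l - n) < (b - 1) * l" .
  moreover have "b * (l - n) = b * l - b * n" "(b - 1) * l = b * l - l"
    by (simp_all add: diff_mult_distrib diff_mult_distrib2)
  moreover have "b * n \<le> l" "l \<le> b * l" using ab(2) by (auto simp: l_def)
  ultimately show False by linarith
qed

text \<open>
  For a rational \<open>a / b\<close> between \<open>Q(1)\<close> and \<open>R(1)\<close>, ones would eventually have frequency below \<open>a / b\<close> by the law
  for \<open>Q\<close>, and the other letters frequency below \<open>1 - a / b\<close> by the law for \<open>R\<close>. The two counts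
  could then not add up to the length.
\<close>

lemma ensemble_prob_le:
  assumes Q: "Q \<in> prob_spaces {0, 1}" and R: "R \<in> prob_spaces {0, 1}"
    and "ensemble {0, 1} Q \<gamma>" "ensemble {0, 1} R \<gamma>"
  shows "R 1 \<le> Q 1"
proof (rule ccontr)
  assume "\<not> R 1 \<le> Q 1"
  moreover have "0 \<le> Q 1" using Q by (simp only: prob_spaces_binary)
  ultimately obtain a b :: nat where ab: "real b * Q 1 < real a" "real a < real b * R 1"
    using nat_fraction_between[of "Q 1" "R 1"] by auto
  have one: "event_prob S ({0, 1} \<inter> {1}) = S 1" for S by (simp add: event_prob_def)
  have rec: "recursive_set {1}"
    using recursive_pred_eq[OF recursive_fun_id recursive_fun_const, of 1]
    by (simp add: recursive_set_def recursive_pred_def)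
  have R1: "R 1 \<le> 1" using R unfolding prob_spaces_binary by simp
  then have "real b * R 1 \<le> real b * 1" by (intro mult_left_mono) auto
  then have "a \<le> b" using ab by simp
  have "real b * event_prob R ({0, 1} \<inter> - {1}) < real (b - a)"
    using ab \<open>a \<le> b\<close> unfolding event_prob_Compl[OF R, of "{1}"] one
    by (simp add: of_nat_diff algebra_simps)
  from eventually_few_occurrences[OF re_set_binary R recursive_set_Compl[OF rec] assms(4) this]
  obtain M where M: "\<And>l. l \<ge> M \<Longrightarrow> b * length (filter (\<lambda>x. x \<in> - {1}) (stake l \<gamma>)) < (b - a) * l" by blast
  have "real b * event_prob Q ({0, 1} \<inter> {1}) < real a" using ab(1) by (simp only: one)
  from eventually_few_occurrences[OF re_set_binary Q rec assms(3) this]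
  obtain N where N: "\<And>l. l \<ge> N \<Longrightarrow> b * length (filter (\<lambda>x. x \<in> {1}) (stake l \<gamma>)) < a * l" by blast
  define l where "l = max M N"
  have "length (filter (\<lambda>x. x \<in> {1}) (stake l \<gamma>)) + length (filter (\<lambda>x. x \<in> - {1}) (stake l \<gamma>)) = l"
    using sum_length_filter_compl[of "\<lambda>x. x \<in> {1}" "stake l \<gamma>"] by simp
  then have "b * l = b * length (filter (\<lambda>x. x \<in> {1}) (stake l \<gamma>)) +
      b * length (filter (\<lambda>x. x \<in> - {1}) (stake l \<gamma>))"
    by (metis distrib_left)
  also have "\<dots> < a * l + (b - a) * l"
    by (intro add_strict_mono M N) (simp_all add: l_def)
  also have "\<dots> = b * l" using \<open>a \<le> b\<close> by (simp add: distrib_right[symmetric])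
  finally show False by simp
qed

lemma ensemble_determines_prob:
  assumes "Q \<in> prob_spaces {0, 1}" "R \<in> prob_spaces {0, 1}"
    "ensemble {0, 1} Q \<gamma>" "ensemble {0, 1} R \<gamma>"
  shows "Q 1 = R 1"
  using ensemble_prob_le[OF assms] ensemble_prob_le[OF assms(2,1,4,3)] by simp

lemma equivalent_over_iff:
  assumes "Q \<in> prob_spaces {0, 1}" "R \<in> prob_spaces {0, 1}"
    "ensemble {0, 1} Q \<gamma>" "ensemble {0, 1} R \<delta>" and "Q 1 = R 1 \<Longrightarrow> Q = R"
  shows "equivalent_over {0, 1} \<gamma> \<delta> \<longleftrightarrow> Q 1 = R 1"
  using assms ensemble_determines_prob unfolding equivalent_over_def by metis


section \<open>Independence and equivalence\<close>

text \<open>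
  The whole functions agree, also outside \<open>{0, 1}\<close>, where both vanish. Hence they have the same ensembles.
\<close>

lemma bit_prob_eqI:
  assumes P: "P \<in> prob_spaces \<Omega>" and "event_prob P (\<Omega> \<inter> B) > 0" "event_prob P (\<Omega> \<inter> D) > 0"
    and "bit_prob \<Omega> P A B 1 = bit_prob \<Omega> P C D 1"
  shows "bit_prob \<Omega> P A B = bit_prob \<Omega> P C D"
proof
  fix x :: nat
  have zero: "bit_prob \<Omega> P A B 0 = bit_prob \<Omega> P C D 0"
    using bit_prob_in_prob_spaces[OF P, of B A] bit_prob_in_prob_spaces[OF P, of D C] assms
    unfolding prob_spaces_binary by linarith
  have "bit_prob \<Omega> P A B x = 0" if "x \<noteq> 0" "x \<noteq> 1" for A B
  proof -
    have "{a \<in> \<Omega> \<inter> B. of_bool (a \<in> A) = x} = {}" using that by auto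
    then show ?thesis by (simp only: bit_prob_def) (simp add: event_prob_def)
  qed
  then show "bit_prob \<Omega> P A B x = bit_prob \<Omega> P C D x"
    using zero assms(4) by (cases "x = 0"; cases "x = 1") auto
qed

theorem theorem40:
  fixes \<Omega> A B :: "nat set" and P :: "nat \<Rightarrow> real"
  assumes "re_set \<Omega>" and "infinite \<Omega>"
    and "P \<in> prob_spaces \<Omega>"
    and "A \<subseteq> \<Omega>" and "recursive_set A"
    and "B \<subseteq> \<Omega>" and "recursive_set B"
    and "event_prob P B > 0"
  shows "(indep_on P A B \<longleftrightarrow>
           (\<forall>\<alpha>. ensemble \<Omega> P \<alpha> \<longrightarrow>
              equivalent_over {0, 1} (char_seq A \<alpha>) (char_seq (A \<inter> B) (filtered B \<alpha>)))) \<and>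
         ((\<forall>\<alpha>. ensemble \<Omega> P \<alpha> \<longrightarrow>
              equivalent_over {0, 1} (char_seq A \<alpha>) (char_seq (A \<inter> B) (filtered B \<alpha>))) \<longleftrightarrow>
           (\<exists>\<alpha>. ensemble \<Omega> P \<alpha> \<and>
              equivalent_over {0, 1} (char_seq A \<alpha>) (char_seq (A \<inter> B) (filtered B \<alpha>))))"
proof -
  have \<Omega>B: "\<Omega> \<inter> B = B" and posB: "event_prob P (\<Omega> \<inter> B) > 0"
    using assms(6,8) by (simp_all add: Int_absorb1)
  have pos\<Omega>: "event_prob P (\<Omega> \<inter> UNIV) > 0"
    using event_prob_space[OF assms(3)] by simp
  define Q where "Q = bit_prob \<Omega> P A UNIV"
  define R where "R = bit_prob \<Omega> P (A \<inter> B) B"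
  have Q: "Q \<in> prob_spaces {0, 1}" and R: "R \<in> prob_spaces {0, 1}"
    unfolding Q_def R_def using bit_prob_in_prob_spaces[OF assms(3)] posB pos\<Omega> by blast+
  have Q1: "Q 1 = event_prob P A"
    using assms(4) event_prob_space[OF assms(3)] unfolding Q_def bit_prob_1
    by (simp add: Int_absorb1)
  have R1: "R 1 = event_prob P (A \<inter> B) / event_prob P B"
    unfolding R_def bit_prob_1 \<Omega>B by (simp add: Int_absorb1 Int_commute Int_left_commute)
  have indep: "indep_on P A B \<longleftrightarrow> Q 1 = R 1"
    unfolding Q1 R1 indep_on_def using assms(8) by (auto simp: field_simps)
  have "equivalent_over {0, 1} (char_seq A \<alpha>) (char_seq (A \<inter> B) (filtered B \<alpha>)) \<longleftrightarrow> indep_on P A B"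
    if \<alpha>: "ensemble \<Omega> P \<alpha>" for \<alpha>
    unfolding indep
  proof (rule equivalent_over_iff[OF Q R])
    show "ensemble {0, 1} Q (char_seq A \<alpha>)"
      unfolding Q_def by (rule ensemble_char_seq[OF assms(1,3,5) \<alpha>])
    have "\<forall>n. \<exists>i\<ge>n. \<alpha> !! i \<in> B"
      using ensemble_infinitely_many[OF assms(1,3,7) \<alpha> posB] by blast
    then show "ensemble {0, 1} R (char_seq (A \<inter> B) (filtered B \<alpha>))"
      unfolding R_def
      by (rule ensemble_char_seq_filtered[OF assms(1,3) recursive_set_Int[OF assms(5,7)] assms(7) posB \<alpha>])
    show "Q 1 = R 1 \<Longrightarrow> Q = R"
      unfolding Q_def R_def by (rule bit_prob_eqI[OF assms(3) pos\<Omega> posB])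
  qed
  then show ?thesis
    using ensemble_exists[OF assms(3)] by blast
qed

end
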